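(* Let $\mathcal C$ be one of the free categories $\mathbf{Mon}$, $\mathbf{SyMon}$, $\mathbf{Rel}$, $\mathbf{Aff}$, $\mathbf{Cart}$ and let $f,g:A\to B$ be two $\mathcal C$ morphism-terms of the same type. Then $f=g$ holds in $\mathcal C$ if and only if the graphs of $f$ and $g$ are identical.
   Context: **Free categories.** Let $P$ be an infinite linearly ordered set of letters and $\mathcal O$ the set of terms freely generated from $P\cup\{\mathrm I\}$ by the binary operation $\cdot$. For each of the five categories the set of objects is $\mathcal O$. Primitive morphism-terms (for all $A,B,C\in\mathcal O$): for $\mathbf{Mon}$: $1_A:A\to A$, $\sigma_A:\mathrm I\cdot A\to A$, $\sigma^i_A:A\to\mathrm I\cdot A$, $\delta_A:A\cdot\mathrm I\to A$, $\delta^i_A:A\to A\cdot\mathrm I$, $\overrightarrow{b}_{A,B,C}:A\cdot(B\cdot C)\to(A\cdot B)\cdot C$, $\overleftarrow{b}_{A,B,C}:(A\cdot B)\cdot C\to A\cdot(B\cdot C)$; for $\mathbf{SyMon}$: those of $\mathbf{Mon}$ and $c_{A,B}:A\cdot B\to B\cdot A$; for $\mathbf{Rel}$: those of $\mathbf{SyMon}$ and $w_A:A\to A\cdot A$; for $\mathbf{Aff}$: those of $\mathbf{SyMon}$ and $k_A:A\to\mathrm I$; for $\mathbf{Cart}$: those of $\mathbf{Rel}$ and $\mathbf{Aff}$. Morphism-terms are built from primitive ones by (typed) composition $gf$ (first $f$, then $g$) and multiplication $f\cdot g:A\cdot B\to C\cdot D$ for $f:A\to C$, $g:B\to D$. Two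 morphism-terms are equal in $\mathcal C$ (represent the same morphism) iff they are related by the smallest equivalence relation (on terms of the same type) that is a congruence for composition and multiplication and contains all instances of the following equations: For $\mathbf{Mon}$ (monoidal equations): $f1_A=f=1_Bf$; $h(gf)=(hg)f$; $(g_1f_1)\cdot(g_2f_2)=(g_1\cdot g_2)(f_1\cdot f_2)$; $1_A\cdot 1_B=1_{A\cdot B}$; $f\sigma_A=\sigma_B(1_{\mathrm I}\cdot f)$ and $f\delta_A=\delta_B(f\cdot 1_{\mathrm I})$ for $f:A\to B$; $\sigma_A\sigma^i_A=1_A$, $\sigma^i_A\sigma_A=1_{\mathrm I\cdot A}$, $\delta_A\delta^i_A=1_A$, $\delta^i_A\delta_A=1_{A\cdot\mathrm I}$; $\sigma_{\mathrm I}=\delta_{\mathrm I}$; $((f\cdot g)\cdot h)\overrightarrow{b}_{A,B,C}=\overrightarrow{b}_{D,E,F}(f\cdot(g\cdot h))$ for $f:A\to D$, $g:B\to E$, $h:C\to F$; $\overrightarrow{b}_{A,B,C}\overleftarrow{b}_{A,B,C}=1$, $\overleftarrow{b}_{A,B,C}\overrightarrow{b}_{A,B,C}=1$; $(\delta_A\cdot 1_B)\overrightarrow{b}_{A,\mathrm I,B}=1_A\cdot\sigma_B$; $\overrightarrow{b}_{A\cdot B,C,D}\overrightarrow{b}_{A,B,C\cdot D}=(\overrightarrow{b}_{A,B,C}\cdot 1_D)\overrightarrow{b}_{A,B\cdot C,D}(1_A\cdot\overrightarrow{b}_{B,C,D})$. For $\mathbf{SyMon}$, additionally: $(g\cdot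 f)c_{A,B}=c_{C,D}(f\cdot g)$ for $f:A\to C$, $g:B\to D$; $c_{B,A}c_{A,B}=1_{A\cdot B}$; $\sigma_Ac_{A,\mathrm I}=\delta_A$; $\overrightarrow{b}_{C,A,B}c_{A\cdot B,C}\overrightarrow{b}_{A,B,C}=(c_{A,C}\cdot 1_B)\overrightarrow{b}_{A,C,B}(1_A\cdot c_{B,C})$. For $\mathbf{Rel}$, those of $\mathbf{SyMon}$ and the $w$-equations: $(f\cdot f)w_A=w_Bf$ for $f:A\to B$; $\sigma_{\mathrm I}w_{\mathrm I}=1_{\mathrm I}$; $\overrightarrow{b}_{A,A,A}(1_A\cdot w_A)w_A=(w_A\cdot 1_A)w_A$; $c_{A,A}w_A=w_A$; $c^m_{A,B,A,B}w_{A\cdot B}=w_A\cdot w_B$, where $c^m_{A,B,C,D}=\overrightarrow{b}_{A,C,B\cdot D}(1_A\cdot(\overleftarrow{b}_{C,B,D}(c_{B,C}\cdot 1_D)\overrightarrow{b}_{B,C,D}))\overleftarrow{b}_{A,B,C\cdot D}$. For $\mathbf{Aff}$, those of $\mathbf{SyMon}$ and the $k$-equations: $k_A=k_Bf$ for $f:A\to B$; $k_{\mathrm I}=1_{\mathrm I}$. For $\mathbf{Cart}$, those of $\mathbf{Rel}$ and $\mathbf{Aff}$ and: $\sigma_A(k_A\cdot 1_A)w_A=1_A$, $\delta_A(1_A\cdot k_A)w_A=1_A$. **Graphs of morphism-terms.** Let $|A|$ be the number of occurrences of letters in $A$. The graph of a morphism-term $f:A\to B$ is a function $\{1,\dots,|B|\}\to\{1,\dots,|A|\}$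 defined by induction: the graphs of $1,\sigma,\sigma^i,\delta,\delta^i,\overrightarrow b,\overleftarrow b$ terms are identity functions; the graph of $c_{A,B}$, with $m=|A|$, $n=|B|$, is $i\mapsto m+i$ for $1\le i\le n$, $n+j\mapsto j$ for $1\le j\le m$; the graph of $w_A$, with $m=|A|$, is $i\mapsto i$, $m+i\mapsto i$ for $1\le i\le m$; the graph of $k_A$ is the empty function; if $f_1:A_1\to B_1$ and $f_2:A_2\to B_2$ have graphs $\Phi,\Psi$, then $f_1\cdot f_2$ has graph $i\mapsto\Phi(i)$ for $1\le i\le|B_1|$, $|B_1|+j\mapsto|A_1|+\Psi(j)$ for $1\le j\le|B_2|$; if $f_1:A\to B$ and $f_2:B\to C$ have graphs $\Phi,\Psi$, then $f_2f_1$ has graph $i\mapsto\Phi(\Psi(i))$. *)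

theory Defs
  imports Main "HOL-Library.FuncSet"
begin

datatype category = Mon | SyMon | Rel | Aff | Cart

datatype 'p obj =
    Letter 'p
  | Unit
  | Prod "'p obj" "'p obj"  (infixr "\<cdot>" 75)

text \<open>Raw morphism-terms; the well-typed ones of each category are selected by \<open>hom\<close> below.
  \<open>\<sigma>i\<close>, \<open>\<delta>i\<close> are the inverses of \<open>\<sigma>\<close>, \<open>\<delta>\<close>; \<open>br\<close> and \<open>bl\<close> are the right- and left-arrow
  associativity terms.  \<open>g \<odot> f\<close> is the composition ``first \<open>f\<close>, then \<open>g\<close>''.\<close>

datatype 'p mterm =
    idt "'p obj"
  | \<sigma> "'p obj"
  | \<sigma>i "'p obj"
  | \<delta> "'p obj"
  | \<delta>i "'p obj"
  | br "'p obj" "'p obj" "'p obj"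
  | bl "'p obj" "'p obj" "'p obj"
  | c "'p obj" "'p obj"
  | w "'p obj"
  | k "'p obj"
  | Comp "'p mterm" "'p mterm"  (infixr "\<odot>" 70)
  | Mult "'p mterm" "'p mterm"  (infixr "\<boxtimes>" 75)

inductive hom :: "category \<Rightarrow> 'p obj \<Rightarrow> 'p obj \<Rightarrow> 'p mterm \<Rightarrow> bool" for C :: category where
  hom_idt: "hom C A A (idt A)"
| hom_sigma: "hom C (Unit \<cdot> A) A (\<sigma> A)"
| hom_sigmai: "hom C A (Unit \<cdot> A) (\<sigma>i A)"
| hom_delta: "hom C (A \<cdot> Unit) A (\<delta> A)"
| hom_deltai: "hom C A (A \<cdot> Unit) (\<delta>i A)"
| hom_br: "hom C (A \<cdot> (B \<cdot> D)) ((A \<cdot> B) \<cdot> D) (br A B D)"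
| hom_bl: "hom C ((A \<cdot> B) \<cdot> D) (A \<cdot> (B \<cdot> D)) (bl A B D)"
| hom_c: "C \<in> {SyMon, Rel, Aff, Cart} \<Longrightarrow> hom C (A \<cdot> B) (B \<cdot> A) (c A B)"
| hom_w: "C \<in> {Rel, Cart} \<Longrightarrow> hom C A (A \<cdot> A) (w A)"
| hom_k: "C \<in> {Aff, Cart} \<Longrightarrow> hom C A Unit (k A)"
| hom_Comp: "hom C A B f \<Longrightarrow> hom C B D g \<Longrightarrow> hom C A D (g \<odot> f)"
| hom_Mult: "hom C A D f \<Longrightarrow> hom C B E g \<Longrightarrow> hom C (A \<cdot> B) (D \<cdot> E) (f \<boxtimes> g)"

definition cm :: "'p obj \<Rightarrow> 'p obj \<Rightarrow> 'p obj \<Rightarrow> 'p obj \<Rightarrow> 'p mterm" where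
  "cm A B D E =
     br A D (B \<cdot> E) \<odot> (idt A \<boxtimes> (bl D B E \<odot> (c B D \<boxtimes> idt E) \<odot> br B D E)) \<odot> bl A B (D \<cdot> E)"

text \<open>\<open>meq C A B f g\<close>: the terms \<open>f, g : A \<rightarrow> B\<close> are equal in \<open>C\<close>.\<close>

inductive meq :: "category \<Rightarrow> 'p obj \<Rightarrow> 'p obj \<Rightarrow> 'p mterm \<Rightarrow> 'p mterm \<Rightarrow> bool"
  for C :: category where
  meq_refl: "hom C A B f \<Longrightarrow> meq C A B f f"
| meq_sym: "meq C A B f g \<Longrightarrow> meq C A B g f"
| meq_trans: "meq C A B f g \<Longrightarrow> meq C A B g h \<Longrightarrow> meq C A B f h"
| meq_Comp: "meq C A B f f' \<Longrightarrow> meq C B D g g' \<Longrightarrow> meq C A D (g \<odot> f) (g' \<odot> f')"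
| meq_Mult: "meq C A D f f' \<Longrightarrow> meq C B E g g' \<Longrightarrow>
    meq C (A \<cdot> B) (D \<cdot> E) (f \<boxtimes> g) (f' \<boxtimes> g')"
| id_right: "hom C A B f \<Longrightarrow> meq C A B (f \<odot> idt A) f"
| id_left: "hom C A B f \<Longrightarrow> meq C A B (idt B \<odot> f) f"
| comp_assoc: "hom C A B f \<Longrightarrow> hom C B D g \<Longrightarrow> hom C D E h \<Longrightarrow>
    meq C A E (h \<odot> (g \<odot> f)) ((h \<odot> g) \<odot> f)"
| interchange: "hom C A1 B1 f1 \<Longrightarrow> hom C B1 D1 g1 \<Longrightarrow>
    hom C A2 B2 f2 \<Longrightarrow> hom C B2 D2 g2 \<Longrightarrow>
    meq C (A1 \<cdot> A2) (D1 \<cdot> D2) ((g1 \<odot> f1) \<boxtimes> (g2 \<odot> f2)) ((g1 \<boxtimes> g2) \<odot> (f1 \<boxtimes> f2))"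
| id_mult: "meq C (A \<cdot> B) (A \<cdot> B) (idt A \<boxtimes> idt B) (idt (A \<cdot> B))"
| sigma_nat: "hom C A B f \<Longrightarrow> meq C (Unit \<cdot> A) B (f \<odot> \<sigma> A) (\<sigma> B \<odot> (idt Unit \<boxtimes> f))"
| delta_nat: "hom C A B f \<Longrightarrow> meq C (A \<cdot> Unit) B (f \<odot> \<delta> A) (\<delta> B \<odot> (f \<boxtimes> idt Unit))"
| sigma_sigmai: "meq C A A (\<sigma> A \<odot> \<sigma>i A) (idt A)"
| sigmai_sigma: "meq C (Unit \<cdot> A) (Unit \<cdot> A) (\<sigma>i A \<odot> \<sigma> A) (idt (Unit \<cdot> A))"
| delta_deltai: "meq C A A (\<delta> A \<odot> \<delta>i A) (idt A)"
| deltai_delta: "meq C (A \<cdot> Unit) (A \<cdot> Unit) (\<delta>i A \<odot> \<delta> A) (idt (A \<cdot> Unit))"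
| sigma_delta: "meq C (Unit \<cdot> Unit) Unit (\<sigma> Unit) (\<delta> Unit)"
| br_nat: "hom C A D f \<Longrightarrow> hom C B E g \<Longrightarrow> hom C G F h \<Longrightarrow>
    meq C (A \<cdot> (B \<cdot> G)) ((D \<cdot> E) \<cdot> F)
      (((f \<boxtimes> g) \<boxtimes> h) \<odot> br A B G) (br D E F \<odot> (f \<boxtimes> (g \<boxtimes> h)))"
| br_bl: "meq C ((A \<cdot> B) \<cdot> D) ((A \<cdot> B) \<cdot> D) (br A B D \<odot> bl A B D) (idt ((A \<cdot> B) \<cdot> D))"
| bl_br: "meq C (A \<cdot> (B \<cdot> D)) (A \<cdot> (B \<cdot> D)) (bl A B D \<odot> br A B D) (idt (A \<cdot> (B \<cdot> D)))"
| triangle: "meq C (A \<cdot> (Unit \<cdot> B)) (A \<cdot> B) ((\<delta> A \<boxtimes> idt B) \<odot> br A Unit B) (idt A \<boxtimes> \<sigma> B)"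
| pentagon: "meq C (A \<cdot> (B \<cdot> (D \<cdot> E))) (((A \<cdot> B) \<cdot> D) \<cdot> E)
    (br (A \<cdot> B) D E \<odot> br A B (D \<cdot> E))
    ((br A B D \<boxtimes> idt E) \<odot> br A (B \<cdot> D) E \<odot> (idt A \<boxtimes> br B D E))"
| c_nat: "C \<in> {SyMon, Rel, Aff, Cart} \<Longrightarrow> hom C A D f \<Longrightarrow> hom C B E g \<Longrightarrow>
    meq C (A \<cdot> B) (E \<cdot> D) ((g \<boxtimes> f) \<odot> c A B) (c D E \<odot> (f \<boxtimes> g))"
| c_c: "C \<in> {SyMon, Rel, Aff, Cart} \<Longrightarrow>
    meq C (A \<cdot> B) (A \<cdot> B) (c B A \<odot> c A B) (idt (A \<cdot> B))"
| sigma_c: "C \<in> {SyMon, Rel, Aff, Cart} \<Longrightarrow>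
    meq C (A \<cdot> Unit) A (\<sigma> A \<odot> c A Unit) (\<delta> A)"
| hexagon: "C \<in> {SyMon, Rel, Aff, Cart} \<Longrightarrow>
    meq C (A \<cdot> (B \<cdot> D)) ((D \<cdot> A) \<cdot> B)
      (br D A B \<odot> c (A \<cdot> B) D \<odot> br A B D)
      ((c A D \<boxtimes> idt B) \<odot> br A D B \<odot> (idt A \<boxtimes> c B D))"
| w_nat: "C \<in> {Rel, Cart} \<Longrightarrow> hom C A B f \<Longrightarrow>
    meq C A (B \<cdot> B) ((f \<boxtimes> f) \<odot> w A) (w B \<odot> f)"
| w_Unit: "C \<in> {Rel, Cart} \<Longrightarrow> meq C Unit Unit (\<sigma> Unit \<odot> w Unit) (idt Unit)"
| w_assoc: "C \<in> {Rel, Cart} \<Longrightarrow>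
    meq C A ((A \<cdot> A) \<cdot> A) (br A A A \<odot> (idt A \<boxtimes> w A) \<odot> w A) ((w A \<boxtimes> idt A) \<odot> w A)"
| c_w: "C \<in> {Rel, Cart} \<Longrightarrow> meq C A (A \<cdot> A) (c A A \<odot> w A) (w A)"
| cm_w: "C \<in> {Rel, Cart} \<Longrightarrow>
    meq C (A \<cdot> B) ((A \<cdot> A) \<cdot> (B \<cdot> B)) (cm A B A B \<odot> w (A \<cdot> B)) (w A \<boxtimes> w B)"
| k_nat: "C \<in> {Aff, Cart} \<Longrightarrow> hom C A B f \<Longrightarrow> meq C A Unit (k A) (k B \<odot> f)"
| k_Unit: "C \<in> {Aff, Cart} \<Longrightarrow> meq C Unit Unit (k Unit) (idt Unit)"
| sigma_k_w: "C = Cart \<Longrightarrow> meq C A A (\<sigma> A \<odot> (k A \<boxtimes> idt A) \<odot> w A) (idt A)"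
| delta_k_w: "C = Cart \<Longrightarrow> meq C A A (\<delta> A \<odot> (idt A \<boxtimes> k A) \<odot> w A) (idt A)"

primrec len :: "'p obj \<Rightarrow> nat" where
  "len (Letter p) = 1"
| "len Unit = 0"
| "len (A \<cdot> B) = len A + len B"

primrec src :: "'p mterm \<Rightarrow> 'p obj" where
  "src (idt A) = A"
| "src (\<sigma> A) = Unit \<cdot> A"
| "src (\<sigma>i A) = A"
| "src (\<delta> A) = A \<cdot> Unit"
| "src (\<delta>i A) = A"
| "src (br A B D) = A \<cdot> (B \<cdot> D)"
| "src (bl A B D) = (A \<cdot> B) \<cdot> D"
| "src (c A B) = A \<cdot> B"
| "src (w A) = A"
| "src (k A) = A"
| "src (g \<odot> f) = src f"
| "src (f \<boxtimes> g) = src f \<cdot> src g"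

primrec tgt :: "'p mterm \<Rightarrow> 'p obj" where
  "tgt (idt A) = A"
| "tgt (\<sigma> A) = A"
| "tgt (\<sigma>i A) = Unit \<cdot> A"
| "tgt (\<delta> A) = A"
| "tgt (\<delta>i A) = A \<cdot> Unit"
| "tgt (br A B D) = (A \<cdot> B) \<cdot> D"
| "tgt (bl A B D) = A \<cdot> (B \<cdot> D)"
| "tgt (c A B) = B \<cdot> A"
| "tgt (w A) = A \<cdot> A"
| "tgt (k A) = Unit"
| "tgt (g \<odot> f) = tgt g"
| "tgt (f \<boxtimes> g) = tgt f \<cdot> tgt g"

text \<open>For \<open>f : A \<rightarrow> B\<close>, the graph is a function from \<open>{1..len B}\<close> to \<open>{1..len A}\<close>, made
  extensional (\<open>undefined\<close> outside \<open>{1..len B}\<close>), so that graphs with the same domain are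
  identical as functions iff they are equal in HOL.\<close>

primrec graph :: "'p mterm \<Rightarrow> nat \<Rightarrow> nat" where
  "graph (idt A) = (\<lambda>i\<in>{1..len A}. i)"
| "graph (\<sigma> A) = (\<lambda>i\<in>{1..len A}. i)"
| "graph (\<sigma>i A) = (\<lambda>i\<in>{1..len A}. i)"
| "graph (\<delta> A) = (\<lambda>i\<in>{1..len A}. i)"
| "graph (\<delta>i A) = (\<lambda>i\<in>{1..len A}. i)"
| "graph (br A B D) = (\<lambda>i\<in>{1..len A + len B + len D}. i)"
| "graph (bl A B D) = (\<lambda>i\<in>{1..len A + len B + len D}. i)"
| "graph (c A B) = (\<lambda>i\<in>{1..len B + len A}. if i \<le> len B then len A + i else i - len B)"
| "graph (w A) = (\<lambda>i\<in>{1..len A + len A}. if i \<le> len A then i else i - len A)"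
| "graph (k A) = (\<lambda>i\<in>{}. undefined)"
| "graph (g \<odot> f) = (\<lambda>i\<in>{1..len (tgt g)}. graph f (graph g i))"
| "graph (f \<boxtimes> g) = (\<lambda>i\<in>{1..len (tgt f) + len (tgt g)}.
     if i \<le> len (tgt f) then graph f i else len (src f) + graph g (i - len (tgt f)))"

lemma hom_src_tgt: "hom C A B f \<Longrightarrow> src f = A \<and> tgt f = B"
  by (induction rule: hom.induct) auto

lemma hom_simps [simp]:
  "hom C X Y (idt A) \<longleftrightarrow> X = A \<and> Y = A"
  "hom C X Y (\<sigma> A) \<longleftrightarrow> X = Unit \<cdot> A \<and> Y = A"
  "hom C X Y (\<sigma>i A) \<longleftrightarrow> X = A \<and> Y = Unit \<cdot> A"
  "hom C X Y (\<delta> A) \<longleftrightarrow> X = A \<cdot> Unit \<and> Y = A"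
  "hom C X Y (\<delta>i A) \<longleftrightarrow> X = A \<and> Y = A \<cdot> Unit"
  "hom C X Y (br A B D) \<longleftrightarrow> X = A \<cdot> (B \<cdot> D) \<and> Y = (A \<cdot> B) \<cdot> D"
  "hom C X Y (bl A B D) \<longleftrightarrow> X = (A \<cdot> B) \<cdot> D \<and> Y = A \<cdot> (B \<cdot> D)"
  "hom C X Y (c A B) \<longleftrightarrow> C \<in> {SyMon, Rel, Aff, Cart} \<and> X = A \<cdot> B \<and> Y = B \<cdot> A"
  "hom C X Y (w A) \<longleftrightarrow> C \<in> {Rel, Cart} \<and> X = A \<and> Y = A \<cdot> A"
  "hom C X Y (k A) \<longleftrightarrow> C \<in> {Aff, Cart} \<and> X = A \<and> Y = Unit"
  "hom C X Y (g \<odot> f) \<longleftrightarrow> (\<exists>B. hom C X B f \<and> hom C B Y g)"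
  "hom C X Y (f \<boxtimes> g) \<longleftrightarrow>
     (\<exists>A B D E. X = A \<cdot> B \<and> Y = D \<cdot> E \<and> hom C A D f \<and> hom C B E g)"
  by (auto elim: hom.cases intro: hom.intros)

lemma cm_hom:
  "C \<in> {SyMon, Rel, Aff, Cart} \<Longrightarrow> hom C ((A \<cdot> B) \<cdot> (D \<cdot> E)) ((A \<cdot> D) \<cdot> (B \<cdot> E)) (cm A B D E)"
  by (simp add: cm_def)

lemma meq_hom: "meq C A B f g \<Longrightarrow> hom C A B f \<and> hom C A B g"
  by (induction rule: meq.induct) (simp_all add: cm_def; blast)+

lemma graph_funcset: "hom C A B f \<Longrightarrow> graph f \<in> {1..len B} \<rightarrow>\<^sub>E {1..len A}"
proof (induction rule: hom.induct)
  case (hom_Comp A B f D g)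
  have st: "tgt g = D"
    using hom_Comp.hyps(2) hom_src_tgt by blast
  have "graph f (graph g i) \<in> {1..len A}" if "i \<in> {1..len D}" for i
    using hom_Comp.IH that by blast
  then show ?case by (auto simp: st)
next
  case (hom_Mult A D f B E g)
  have st: "src f = A" "tgt f = D" "tgt g = E"
    using hom_src_tgt[OF hom_Mult.hyps(1)] hom_src_tgt[OF hom_Mult.hyps(2)] by simp_all
  show ?case
  proof (rule PiE_I)
    fix i assume i: "i \<in> {1..len (D \<cdot> E)}"
    show "graph (f \<boxtimes> g) i \<in> {1..len (A \<cdot> B)}"
    proof (cases "i \<le> len D")
      case True
      then have "graph f i \<in> {1..len A}"
        using i by (intro PiE_mem[OF hom_Mult.IH(1)]) simp
      then show ?thesis using True i by (simp add: st)
    next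
      case False
      then have "graph g (i - len D) \<in> {1..len B}"
        using i by (intro PiE_mem[OF hom_Mult.IH(2)]) auto
      then show ?thesis using False i by (simp add: st)
    qed
  qed (auto simp: st)
qed (auto simp: PiE_iff extensional_def)

end

theory Submission
  imports Defs
begin

text \<open>Soundness is a check of each equation. For completeness, rename the letters so that those of
  the source are pairwise distinct: two terms with equal graphs lift to two parallel terms over the
  new letters, so it suffices that parallel terms with such a source are equal.

  By Mac Lane's argument parallel monoidal terms are equal, hence every morphism can be conjugated
  into one between right-nested products, i.e. between words, for which the tensor product is
  strictly associative and unital. In this strict category a letter of the source can be
  split off: for a predicate \<open>Q\<close> on letters, the unshuffle \<open>xs \<rightarrow> filter Q xs @ filter (\<not> Q) xs\<close> is an
  isomorphism natural in \<open>xs\<close>, where the case of \<open>w\<close> is exactly the axiom relating \<open>cm\<close> and \<open>w\<close>.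
  So one can induct on the length of the source word. When it is a single letter \<open>p\<close>, every morphism
  to \<open>p\<^sup>n\<close> is the iterated diagonal.\<close>

section \<open>Morphisms as equivalence classes\<close>

text \<open>Renaming is what removes graphs from the completeness half. A graph says which source
  letter each target letter comes from, so two lifts with equal graphs have the same target, and
  what is left to prove is that a source without repetitions admits at most one morphism to each
  target. Distinctness is essential here: \<open>c (Letter p) (Letter p)\<close> is parallel to an
  identity and has a different graph. The same obstacle returns for a single letter p, since the
  words p^m met on the way do have nontrivial symmetries. The induction over morphisms out of p^m
  therefore compares only their composites with the diagonal from p to p^m, which absorbs
  permutations by cocommutativity. Splitting a word by a predicate works because no generator
  relates different letters except by moving one past another. It uses the symmetry, so
  \<open>Mon\<close> is settled by monoidal coherence alone.\<close>

lemma hom_mono: "hom Mon A B f \<Longrightarrow> hom C A B f"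
  by (induction rule: hom.induct) (auto intro: hom.intros simp del: hom_simps)

locale free_category =
  fixes C :: category
begin

text \<open>Ill-typed terms have the empty class, so that the laws below need no typing hypotheses where
  both sides are typed under the same conditions.\<close>

definition cl :: "'p mterm \<Rightarrow> 'p mterm set" where
  "cl f = {g. meq C (src f) (tgt f) f g}"

definition cmp :: "'p mterm set \<Rightarrow> 'p mterm set \<Rightarrow> 'p mterm set"  (infixr "\<bullet>" 70) where
  "N \<bullet> M = {h. \<exists>g\<in>N. \<exists>f\<in>M. meq C (src f) (tgt g) (g \<odot> f) h}"

definition tns :: "'p mterm set \<Rightarrow> 'p mterm set \<Rightarrow> 'p mterm set"  (infixr "\<otimes>" 75) where
  "M \<otimes> N = {h. \<exists>f\<in>M. \<exists>g\<in>N. meq C (src f \<cdot> src g) (tgt f \<cdot> tgt g) (f \<boxtimes> g) h}"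

definition valid :: "'p mterm set \<Rightarrow> bool" where
  "valid M \<longleftrightarrow> (\<exists>A B f. hom C A B f \<and> M = cl f)"

text \<open>All members of the class of a typed term share its type, so on valid sets every choice
  gives the same object.\<close>

definition dom :: "'p mterm set \<Rightarrow> 'p obj" where
  "dom M = src (SOME f. f \<in> M)"

definition cod :: "'p mterm set \<Rightarrow> 'p obj" where
  "cod M = tgt (SOME f. f \<in> M)"

lemma meq_src_tgt: "meq C A B f g \<Longrightarrow> src f = A \<and> tgt f = B \<and> src g = A \<and> tgt g = B"
  by (meson hom_src_tgt meq_hom)

lemma cl_eq_iff: "hom C A B f \<Longrightarrow> cl f = cl g \<longleftrightarrow> meq C A B f g"
proof
  assume f: "hom C A B f" and e: "cl f = cl g"
  have "f \<in> cl f" using hom_src_tgt[OF f] f by (simp add: cl_def meq_refl)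
  then have gf: "meq C (src g) (tgt g) g f" unfolding e by (simp add: cl_def)
  then show "meq C A B f g" using meq_src_tgt[OF gf] hom_src_tgt[OF f] meq_sym by metis
next
  assume f: "hom C A B f" and m: "meq C A B f g"
  have "meq C A B f h \<longleftrightarrow> meq C A B g h" for h
    using m by (meson meq_sym meq_trans)
  then show "cl f = cl g" using meq_src_tgt[OF m] by (simp add: cl_def)
qed

lemma cl_eqI: "meq C A B f g \<Longrightarrow> cl f = cl g"
  using cl_eq_iff[of A B f g] meq_hom[of C A B f g] by simp

lemma cl_dom_cod: "hom C A B f \<Longrightarrow> valid (cl f) \<and> dom (cl f) = A \<and> cod (cl f) = B"
proof -
  assume f: "hom C A B f"
  then have "f \<in> cl f" using hom_src_tgt[OF f] by (simp add: cl_def meq_refl)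
  then have "(SOME g. g \<in> cl f) \<in> cl f" by (rule someI)
  then have "meq C A B f (SOME g. g \<in> cl f)"
    using hom_src_tgt[OF f] by (simp add: cl_def)
  then have "dom (cl f) = A \<and> cod (cl f) = B"
    unfolding dom_def cod_def using meq_src_tgt by blast
  then show ?thesis using f unfolding valid_def by blast
qed

lemma validE:
  assumes "valid M" obtains f where "hom C (dom M) (cod M) f" "M = cl f"
proof -
  obtain A B f where "hom C A B f" "M = cl f" using assms(1) unfolding valid_def by blast
  then show ?thesis using that cl_dom_cod by metis
qed

lemma cmp_cl: "hom C A B f \<Longrightarrow> hom C B D g \<Longrightarrow> cl g \<bullet> cl f = cl (g \<odot> f)"
proof -
  assume f: "hom C A B f" and g: "hom C B D g"
  have st: "src f = A" "tgt f = B" "src g = B" "tgt g = D"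
    using hom_src_tgt f g by blast+
  have "h \<in> cl g \<bullet> cl f \<longleftrightarrow> h \<in> cl (g \<odot> f)" for h
  proof
    assume "h \<in> cl g \<bullet> cl f"
    then obtain g' f' where "meq C B D g g'" "meq C A B f f'"
        "meq C (src f') (tgt g') (g' \<odot> f') h"
      using st by (auto simp: cmp_def cl_def)
    moreover have "src f' = A" "tgt g' = D" using calculation meq_src_tgt by blast+
    ultimately show "h \<in> cl (g \<odot> f)"
      unfolding cl_def src.simps tgt.simps st mem_Collect_eq
      by (metis meq_Comp meq_trans)
  next
    assume "h \<in> cl (g \<odot> f)"
    then show "h \<in> cl g \<bullet> cl f" using st f g
      unfolding cl_def cmp_def by (fastforce intro: meq_refl)
  qed
  then show ?thesis by blast
qed

lemma tns_cl: "hom C A B f \<Longrightarrow> hom C D E g \<Longrightarrow> cl f \<otimes> cl g = cl (f \<boxtimes> g)"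
proof -
  assume f: "hom C A B f" and g: "hom C D E g"
  have st: "src f = A" "tgt f = B" "src g = D" "tgt g = E"
    using hom_src_tgt f g by blast+
  have "h \<in> cl f \<otimes> cl g \<longleftrightarrow> h \<in> cl (f \<boxtimes> g)" for h
  proof
    assume "h \<in> cl f \<otimes> cl g"
    then obtain g' f' where *: "meq C D E g g'" "meq C A B f f'"
        "meq C (src f' \<cdot> src g') (tgt f' \<cdot> tgt g') (f' \<boxtimes> g') h"
      using st by (auto simp: tns_def cl_def)
    moreover have "src f' = A" "tgt f' = B" "src g' = D" "tgt g' = E"
      using * meq_src_tgt by blast+
    ultimately show "h \<in> cl (f \<boxtimes> g)"
      unfolding cl_def src.simps tgt.simps st mem_Collect_eq
      by (metis meq_Mult meq_trans)
  next
    assume "h \<in> cl (f \<boxtimes> g)"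
    then show "h \<in> cl f \<otimes> cl g" using st f g
      unfolding cl_def tns_def by (fastforce intro: meq_refl)
  qed
  then show ?thesis by blast
qed

lemma valid_cmp [simp]: "valid M \<Longrightarrow> valid N \<Longrightarrow> cod M = dom N \<Longrightarrow> valid (N \<bullet> M)"
  and dom_cmp [simp]: "valid M \<Longrightarrow> valid N \<Longrightarrow> cod M = dom N \<Longrightarrow> dom (N \<bullet> M) = dom M"
  and cod_cmp [simp]: "valid M \<Longrightarrow> valid N \<Longrightarrow> cod M = dom N \<Longrightarrow> cod (N \<bullet> M) = cod N"
proof -
  assume M: "valid M" and N: "valid N" and eq: "cod M = dom N"
  obtain f where f: "hom C (dom M) (cod M) f" "M = cl f" using M by (rule validE)
  obtain g where g: "hom C (dom N) (cod N) g" "N = cl g" using N by (rule validE)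
  have "hom C (dom M) (cod N) (g \<odot> f)"
    using hom_Comp[OF f(1)] g(1) eq by metis
  then have *: "valid (cl (g \<odot> f)) \<and> dom (cl (g \<odot> f)) = dom M \<and> cod (cl (g \<odot> f)) = cod N"
    by (rule cl_dom_cod)
  have "N \<bullet> M = cl (g \<odot> f)"
    using cmp_cl[OF f(1) g(1)[folded eq]] f(2) g(2) by simp
  then show "valid (N \<bullet> M)" "dom (N \<bullet> M) = dom M" "cod (N \<bullet> M) = cod N"
    using * by metis+
qed

lemma valid_tns [simp]: "valid M \<Longrightarrow> valid N \<Longrightarrow> valid (M \<otimes> N)"
  and dom_tns [simp]: "valid M \<Longrightarrow> valid N \<Longrightarrow> dom (M \<otimes> N) = dom M \<cdot> dom N"
  and cod_tns [simp]: "valid M \<Longrightarrow> valid N \<Longrightarrow> cod (M \<otimes> N) = cod M \<cdot> cod N"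
proof -
  assume M: "valid M" and N: "valid N"
  obtain f where f: "hom C (dom M) (cod M) f" "M = cl f" using M by (rule validE)
  obtain g where g: "hom C (dom N) (cod N) g" "N = cl g" using N by (rule validE)
  have *: "valid (cl (f \<boxtimes> g)) \<and> dom (cl (f \<boxtimes> g)) = dom M \<cdot> dom N \<and> cod (cl (f \<boxtimes> g)) = cod M \<cdot> cod N"
    by (rule cl_dom_cod[OF hom_Mult[OF f(1) g(1)]])
  have "M \<otimes> N = cl (f \<boxtimes> g)"
    unfolding f(2) g(2) by (rule tns_cl[OF f(1) g(1)])
  then show "valid (M \<otimes> N)" "dom (M \<otimes> N) = dom M \<cdot> dom N" "cod (M \<otimes> N) = cod M \<cdot> cod N"
    using * by metis+
qed

lemma prim [simp]:
  "valid (cl (idt A))" "dom (cl (idt A)) = A" "cod (cl (idt A)) = A"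
  "valid (cl (\<sigma> A))" "dom (cl (\<sigma> A)) = Unit \<cdot> A" "cod (cl (\<sigma> A)) = A"
  "valid (cl (\<sigma>i A))" "dom (cl (\<sigma>i A)) = A" "cod (cl (\<sigma>i A)) = Unit \<cdot> A"
  "valid (cl (\<delta> A))" "dom (cl (\<delta> A)) = A \<cdot> Unit" "cod (cl (\<delta> A)) = A"
  "valid (cl (\<delta>i A))" "dom (cl (\<delta>i A)) = A" "cod (cl (\<delta>i A)) = A \<cdot> Unit"
  "valid (cl (br A B D))" "dom (cl (br A B D)) = A \<cdot> (B \<cdot> D)" "cod (cl (br A B D)) = (A \<cdot> B) \<cdot> D"
  "valid (cl (bl A B D))" "dom (cl (bl A B D)) = (A \<cdot> B) \<cdot> D" "cod (cl (bl A B D)) = A \<cdot> (B \<cdot> D)"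
  by (simp_all add: cl_dom_cod[OF hom_idt] cl_dom_cod[OF hom_sigma] cl_dom_cod[OF hom_sigmai]
    cl_dom_cod[OF hom_delta] cl_dom_cod[OF hom_deltai] cl_dom_cod[OF hom_br] cl_dom_cod[OF hom_bl])

lemma cl_empty: "cl f = {} \<longleftrightarrow> (\<nexists>A B. hom C A B f)"
proof
  assume e: "cl f = {}"
  show "\<nexists>A B. hom C A B f"
  proof clarify
    fix A B assume "hom C A B f"
    then have "f \<in> cl f" by (auto simp: cl_def dest: hom_src_tgt intro: meq_refl)
    then show False using e by simp
  qed
qed (auto simp: cl_def dest: meq_hom)

lemma cl_Comp [simp]: "cl (g \<odot> f) = cl g \<bullet> cl f"
proof (cases "\<exists>A D. hom C A D (g \<odot> f)")
  case True
  then show ?thesis using cmp_cl by fastforce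
next
  case False
  \<comment> \<open>Members of a class have the type of its representative, so a composable pair
    taken from the two classes would make \<open>g \<odot> f\<close> typed.\<close>
  have "x \<notin> cl g \<bullet> cl f" for x
  proof
    assume "x \<in> cl g \<bullet> cl f"
    then obtain g' f' A D where "hom C A D (g' \<odot> f')" "g' \<in> cl g" "f' \<in> cl f"
      unfolding cmp_def using meq_hom by blast
    then have "hom C A D (g \<odot> f)"
      unfolding cl_def by (metis hom_simps(11) hom_src_tgt mem_Collect_eq meq_hom meq_src_tgt)
    then show False using False by blast
  qed
  then show ?thesis using False cl_empty by blast
qed

lemma cl_Mult [simp]: "cl (f \<boxtimes> g) = cl f \<otimes> cl g"
proof (cases "\<exists>A D. hom C A D (f \<boxtimes> g)")
  case True
  then show ?thesis using tns_cl by fastforce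
next
  case False
  have "x \<notin> cl f \<otimes> cl g" for x
  proof
    assume "x \<in> cl f \<otimes> cl g"
    then obtain g' f' where "f' \<in> cl f" "g' \<in> cl g"
      unfolding tns_def by blast
    then have "\<exists>A D. hom C A D (f \<boxtimes> g)"
      unfolding cl_def by (metis hom_simps(12) mem_Collect_eq meq_hom)
    then show False using False by blast
  qed
  then show ?thesis using False cl_empty by blast
qed

text \<open>Ill-typed composites contribute no elements on either side, so the law holds for
  arbitrary sets and can normalise every composite to right-nested form. Both sides are first
  described by triples of representatives.\<close>

lemma cmp_assoc [simp]: fixes M N P :: "'a mterm set" shows "(P \<bullet> N) \<bullet> M = P \<bullet> (N \<bullet> M)"
proof -
  have l: "(x \<in> (P \<bullet> N) \<bullet> M) \<longleftrightarrow>
      (\<exists>h\<in>P. \<exists>g\<in>N. \<exists>f\<in>M. meq C (src f) (tgt h) ((h \<odot> g) \<odot> f) x)" for x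
  proof
    assume "x \<in> (P \<bullet> N) \<bullet> M"
    then obtain y h g f where "h \<in> P" "g \<in> N" "f \<in> M" "meq C (src g) (tgt h) (h \<odot> g) y"
        "meq C (src f) (tgt y) (y \<odot> f) x"
      unfolding cmp_def by blast
    moreover have "meq C (src f) (tgt h) ((h \<odot> g) \<odot> f) (y \<odot> f)"
      using calculation meq_src_tgt[OF calculation(4)] meq_hom[OF calculation(5)]
      by (metis hom_simps(11) hom_src_tgt meq_Comp meq_refl)
    ultimately show "\<exists>h\<in>P. \<exists>g\<in>N. \<exists>f\<in>M. meq C (src f) (tgt h) ((h \<odot> g) \<odot> f) x"
      by (metis meq_src_tgt meq_trans)
  next
    assume "\<exists>h\<in>P. \<exists>g\<in>N. \<exists>f\<in>M. meq C (src f) (tgt h) ((h \<odot> g) \<odot> f) x"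
    then obtain h g f where *: "h \<in> P" "g \<in> N" "f \<in> M" "meq C (src f) (tgt h) ((h \<odot> g) \<odot> f) x"
      by blast
    then have "meq C (src g) (tgt h) (h \<odot> g) (h \<odot> g)"
      by (metis hom_simps(11) hom_src_tgt meq_hom meq_refl)
    then have "h \<odot> g \<in> P \<bullet> N" using * unfolding cmp_def by blast
    then show "x \<in> (P \<bullet> N) \<bullet> M" using * unfolding cmp_def[of "P \<bullet> N"] by force
  qed
  have r: "(x \<in> P \<bullet> (N \<bullet> M)) \<longleftrightarrow>
      (\<exists>h\<in>P. \<exists>g\<in>N. \<exists>f\<in>M. meq C (src f) (tgt h) (h \<odot> (g \<odot> f)) x)" for x
  proof
    assume "x \<in> P \<bullet> (N \<bullet> M)"
    then obtain y h g f where "h \<in> P" "g \<in> N" "f \<in> M" "meq C (src f) (tgt g) (g \<odot> f) y"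
        "meq C (src y) (tgt h) (h \<odot> y) x"
      unfolding cmp_def by blast
    moreover have "meq C (src f) (tgt h) (h \<odot> (g \<odot> f)) (h \<odot> y)"
      using calculation meq_src_tgt[OF calculation(4)] meq_hom[OF calculation(5)]
      by (metis hom_simps(11) hom_src_tgt meq_Comp meq_refl)
    ultimately show "\<exists>h\<in>P. \<exists>g\<in>N. \<exists>f\<in>M. meq C (src f) (tgt h) (h \<odot> (g \<odot> f)) x"
      by (metis meq_src_tgt meq_trans)
  next
    assume "\<exists>h\<in>P. \<exists>g\<in>N. \<exists>f\<in>M. meq C (src f) (tgt h) (h \<odot> (g \<odot> f)) x"
    then obtain h g f where *: "h \<in> P" "g \<in> N" "f \<in> M" "meq C (src f) (tgt h) (h \<odot> (g \<odot> f)) x"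
      by blast
    then have "meq C (src f) (tgt g) (g \<odot> f) (g \<odot> f)"
      by (metis hom_simps(11) hom_src_tgt meq_hom meq_refl)
    then have "g \<odot> f \<in> N \<bullet> M" using * unfolding cmp_def by blast
    then show "x \<in> P \<bullet> (N \<bullet> M)" using * unfolding cmp_def[of P] by force
  qed
  have "(meq C A B ((h \<odot> g) \<odot> f) x) = meq C A B (h \<odot> (g \<odot> f)) x" for A B and h g f x :: "'a mterm"
  proof -
    have "hom C A B ((h \<odot> g) \<odot> f) \<or> hom C A B (h \<odot> (g \<odot> f)) \<Longrightarrow>
      meq C A B (h \<odot> (g \<odot> f)) ((h \<odot> g) \<odot> f)"
      using comp_assoc by fastforce
    then show ?thesis by (meson meq_hom meq_sym meq_trans)
  qed
  then show ?thesis by (intro set_eqI) (simp only: l r)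
qed

lemma cmp_idt [simp]: "valid M \<Longrightarrow> dom M = A \<Longrightarrow> M \<bullet> cl (idt A) = M"
  and idt_cmp [simp]: "valid M \<Longrightarrow> cod M = A \<Longrightarrow> cl (idt A) \<bullet> M = M"
proof -
  assume "valid M"
  then obtain f where f: "hom C (dom M) (cod M) f" "M = cl f" by (rule validE)
  show "dom M = A \<Longrightarrow> M \<bullet> cl (idt A) = M" "cod M = A \<Longrightarrow> cl (idt A) \<bullet> M = M"
    using cl_eqI[OF id_right[OF f(1)]] cl_eqI[OF id_left[OF f(1)]] f(2) by simp_all
qed

lemma idt_tns [simp]: "cl (idt A) \<otimes> cl (idt B) = cl (idt (A \<cdot> B))"
  using cl_eqI[OF id_mult] by simp

lemma interchange_cl:
  assumes "valid M" "valid N" "valid P" "valid Q" "cod M = dom P" "cod N = dom Q"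
  shows "(P \<otimes> Q) \<bullet> (M \<otimes> N) = (P \<bullet> M) \<otimes> (Q \<bullet> N)"
proof -
  obtain f g h i where *: "hom C (dom M) (cod M) f" "M = cl f" "hom C (dom N) (cod N) g" "N = cl g"
    "hom C (dom P) (cod P) h" "P = cl h" "hom C (dom Q) (cod Q) i" "Q = cl i"
    using validE[OF assms(1)] validE[OF assms(2)] validE[OF assms(3)] validE[OF assms(4)] by metis
  have "cl ((h \<odot> f) \<boxtimes> (i \<odot> g)) = cl ((h \<boxtimes> i) \<odot> (f \<boxtimes> g))"
    by (rule cl_eqI, rule interchange[OF *(1) *(5)[folded assms(5)] *(3) *(7)[folded assms(6)]])
  then show ?thesis using * by simp
qed

text \<open>In a right-nested composite the two factors to be merged are usually followed by a tail
  \<open>R\<close>; this variant rewrites them in place.\<close>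

lemma interchange_cl' [simp]:
  assumes "valid M" "valid N" "valid P" "valid Q" "cod M = dom P" "cod N = dom Q"
  shows "(P \<otimes> Q) \<bullet> (M \<otimes> N) \<bullet> R = ((P \<bullet> M) \<otimes> (Q \<bullet> N)) \<bullet> R"
  using interchange_cl[OF assms] by (metis cmp_assoc)

declare interchange_cl [simp]

section \<open>Naturality, inverses and unit laws for classes\<close>

lemma sigma_natural: "valid M \<Longrightarrow> dom M = A \<Longrightarrow> M \<bullet> cl (\<sigma> A) = cl (\<sigma> (cod M)) \<bullet> (cl (idt Unit) \<otimes> M)"
proof -
  assume "valid M"
  then obtain f where f: "hom C (dom M) (cod M) f" "M = cl f" by (rule validE)
  show "dom M = A \<Longrightarrow> ?thesis" using cl_eqI[OF sigma_nat[OF f(1)]] f(2) by simp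
qed

lemma delta_natural: "valid M \<Longrightarrow> dom M = A \<Longrightarrow> M \<bullet> cl (\<delta> A) = cl (\<delta> (cod M)) \<bullet> (M \<otimes> cl (idt Unit))"
proof -
  assume "valid M"
  then obtain f where f: "hom C (dom M) (cod M) f" "M = cl f" by (rule validE)
  show "dom M = A \<Longrightarrow> ?thesis" using cl_eqI[OF delta_nat[OF f(1)]] f(2) by simp
qed

lemma br_natural:
  assumes "valid M" "valid N" "valid P" "dom M = A" "dom N = B" "dom P = D"
  shows "((M \<otimes> N) \<otimes> P) \<bullet> cl (br A B D) = cl (br (cod M) (cod N) (cod P)) \<bullet> (M \<otimes> (N \<otimes> P))"
proof -
  obtain f g h where *: "hom C (dom M) (cod M) f" "M = cl f" "hom C (dom N) (cod N) g" "N = cl g"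
    "hom C (dom P) (cod P) h" "P = cl h"
    using validE[OF assms(1)] validE[OF assms(2)] validE[OF assms(3)] by metis
  show ?thesis using cl_eqI[OF br_nat[OF *(1,3,5)]] * assms by simp
qed

lemma inverse_cl [simp]:
  "cl (\<sigma> A) \<bullet> cl (\<sigma>i A) = cl (idt A)"
  "cl (\<sigma>i A) \<bullet> cl (\<sigma> A) = cl (idt (Unit \<cdot> A))"
  "cl (\<delta> A) \<bullet> cl (\<delta>i A) = cl (idt A)"
  "cl (\<delta>i A) \<bullet> cl (\<delta> A) = cl (idt (A \<cdot> Unit))"
  "cl (br A B D) \<bullet> cl (bl A B D) = cl (idt ((A \<cdot> B) \<cdot> D))"
  "cl (bl A B D) \<bullet> cl (br A B D) = cl (idt (A \<cdot> (B \<cdot> D)))"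
  using cl_eqI[OF sigma_sigmai] cl_eqI[OF sigmai_sigma] cl_eqI[OF delta_deltai]
    cl_eqI[OF deltai_delta] cl_eqI[OF br_bl] cl_eqI[OF bl_br] by simp_all

lemma inverse_cl' [simp]:
  "valid M \<Longrightarrow> cod M = A \<Longrightarrow> cl (\<sigma> A) \<bullet> cl (\<sigma>i A) \<bullet> M = M"
  "valid M \<Longrightarrow> cod M = Unit \<cdot> A \<Longrightarrow> cl (\<sigma>i A) \<bullet> cl (\<sigma> A) \<bullet> M = M"
  "valid M \<Longrightarrow> cod M = A \<Longrightarrow> cl (\<delta> A) \<bullet> cl (\<delta>i A) \<bullet> M = M"
  "valid M \<Longrightarrow> cod M = A \<cdot> Unit \<Longrightarrow> cl (\<delta>i A) \<bullet> cl (\<delta> A) \<bullet> M = M"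
  "valid M \<Longrightarrow> cod M = (A \<cdot> B) \<cdot> D \<Longrightarrow> cl (br A B D) \<bullet> cl (bl A B D) \<bullet> M = M"
  "valid M \<Longrightarrow> cod M = A \<cdot> (B \<cdot> D) \<Longrightarrow> cl (bl A B D) \<bullet> cl (br A B D) \<bullet> M = M"
  by (simp_all flip: cmp_assoc)

lemma triangle_cl: "(cl (\<delta> A) \<otimes> cl (idt B)) \<bullet> cl (br A Unit B) = cl (idt A) \<otimes> cl (\<sigma> B)"
  using cl_eqI[OF triangle] by simp

lemma pentagon_cl: "cl (br (A \<cdot> B) D E) \<bullet> cl (br A B (D \<cdot> E)) =
    (cl (br A B D) \<otimes> cl (idt E)) \<bullet> cl (br A (B \<cdot> D) E) \<bullet> (cl (idt A) \<otimes> cl (br B D E))"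
  using cl_eqI[OF pentagon] by simp

text \<open>\<open>\<sigma>\<close> is a natural isomorphism, so tensoring with \<open>Unit\<close>
  is faithful.\<close>

lemma Unit_tns_cancel:
  assumes "valid M" "valid N" "dom M = dom N" "cod M = cod N" "cl (idt Unit) \<otimes> M = cl (idt Unit) \<otimes> N"
  shows "M = N"
proof -
  have "M \<bullet> cl (\<sigma> (dom M)) \<bullet> cl (\<sigma>i (dom M)) = N \<bullet> cl (\<sigma> (dom M)) \<bullet> cl (\<sigma>i (dom M))"
    using sigma_natural assms by (metis cmp_assoc)
  then show ?thesis using assms by simp
qed

text \<open>Kelly's argument: this unit law is not among the axioms. Tensored with
  \<open>Unit\<close> on the left, both sides are compared through the pentagon for
  \<open>Unit, Unit, A, B\<close> and two triangles; then the associator and the extra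
  \<open>Unit\<close> are cancelled.\<close>

lemma left_unit_assoc: "(cl (\<sigma> A) \<otimes> cl (idt B)) \<bullet> cl (br Unit A B) = cl (\<sigma> (A \<cdot> B))"
proof -
  let ?i = "\<lambda>A. cl (idt A)" and ?b = "\<lambda>A B D. cl (br A B D)"
  have "?b Unit A B \<bullet> (?i Unit \<otimes> cl (\<sigma> (A \<cdot> B)))
      = ?b Unit A B \<bullet> (cl (\<delta> Unit) \<otimes> (?i A \<otimes> ?i B)) \<bullet> ?b Unit Unit (A \<cdot> B)"
    by (simp add: triangle_cl)
  also have "\<dots> = ((cl (\<delta> Unit) \<otimes> ?i A) \<otimes> ?i B) \<bullet> ?b (Unit \<cdot> Unit) A B \<bullet> ?b Unit Unit (A \<cdot> B)"
    using br_natural[of "cl (\<delta> Unit)" "?i A" "?i B"] by (simp flip: cmp_assoc)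
  also have "\<dots> = (((cl (\<delta> Unit) \<otimes> ?i A) \<bullet> ?b Unit Unit A) \<otimes> ?i B) \<bullet> ?b Unit (Unit \<cdot> A) B \<bullet>
      (?i Unit \<otimes> ?b Unit A B)"
    by (simp add: pentagon_cl)
  also have "\<dots> = ((?i Unit \<otimes> cl (\<sigma> A)) \<otimes> ?i B) \<bullet> ?b Unit (Unit \<cdot> A) B \<bullet>
      (?i Unit \<otimes> ?b Unit A B)"
    by (simp add: triangle_cl)
  also have "\<dots> = ?b Unit A B \<bullet> (?i Unit \<otimes> (cl (\<sigma> A) \<otimes> ?i B)) \<bullet> (?i Unit \<otimes> ?b Unit A B)"
    using br_natural[of "?i Unit" "cl (\<sigma> A)" "?i B"] by (simp flip: cmp_assoc del: interchange_cl interchange_cl')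
  finally have "cl (bl Unit A B) \<bullet> ?b Unit A B \<bullet> (?i Unit \<otimes> cl (\<sigma> (A \<cdot> B))) =
     cl (bl Unit A B) \<bullet> ?b Unit A B \<bullet> (?i Unit \<otimes> (cl (\<sigma> A) \<otimes> ?i B)) \<bullet> (?i Unit \<otimes> ?b Unit A B)"
    by simp
  then have "cl (idt Unit) \<otimes> ((cl (\<sigma> A) \<otimes> ?i B) \<bullet> ?b Unit A B) = cl (idt Unit) \<otimes> cl (\<sigma> (A \<cdot> B))"
    by simp
  then show ?thesis by (rule Unit_tns_cancel[rotated 4]) simp_all
qed

end

section \<open>Monoidal coherence\<close>

primrec flat :: "'p obj \<Rightarrow> 'p list" where
  "flat (Letter p) = [p]"
| "flat Unit = []"
| "flat (A \<cdot> B) = flat A @ flat B"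

primrec nested :: "'p list \<Rightarrow> 'p obj" where
  "nested [] = Unit"
| "nested (p # ps) = Letter p \<cdot> nested ps"

text \<open>Reads an object as the operation of prepending its letters. Product becomes composition
  and \<open>Unit\<close> the identity map, so associativity and unit laws hold on the nose.\<close>

primrec app :: "'p obj \<Rightarrow> 'p obj \<Rightarrow> 'p obj" where
  "app (Letter p) X = Letter p \<cdot> X"
| "app Unit X = X"
| "app (A \<cdot> B) X = app A (app B X)"

lemma flat_nested [simp]: "flat (nested ps) = ps"
  by (induction ps) auto

lemma app_nested: "app A (nested ps) = nested (flat A @ ps)"
  by (induction A arbitrary: ps) auto

lemma app_Unit: "app A Unit = nested (flat A)"
  using app_nested[of A "[]"] by simp

context free_category
begin

definition mon :: "'p mterm set \<Rightarrow> bool" where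
  "mon M \<longleftrightarrow> (\<exists>A B f. hom Mon A B f \<and> M = cl f)"

lemma mon_valid [simp]: "mon M \<Longrightarrow> valid M"
  unfolding mon_def valid_def using hom_mono by blast

lemma monE:
  assumes "mon M" obtains f where "hom Mon (dom M) (cod M) f" "M = cl f"
proof -
  obtain A B f where f: "hom Mon A B f" "M = cl f" using assms unfolding mon_def by blast
  then show ?thesis using that cl_dom_cod[OF hom_mono[OF f(1)]] by metis
qed

lemma mon_cmp [simp]:
  assumes "mon M" "mon N" "cod M = dom N" shows "mon (N \<bullet> M)"
proof -
  obtain f where f: "hom Mon (dom M) (cod M) f" "M = cl f" using assms(1) by (rule monE)
  obtain g where g: "hom Mon (dom N) (cod N) g" "N = cl g" using assms(2) by (rule monE)
  have "N \<bullet> M = cl (g \<odot> f)" using f(2) g(2) by simp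
  then show ?thesis unfolding mon_def using hom_Comp[OF f(1) g(1)[folded assms(3)]] by blast
qed

lemma mon_tns [simp]:
  assumes "mon M" "mon N" shows "mon (M \<otimes> N)"
proof -
  obtain f where f: "hom Mon (dom M) (cod M) f" "M = cl f" using assms(1) by (rule monE)
  obtain g where g: "hom Mon (dom N) (cod N) g" "N = cl g" using assms(2) by (rule monE)
  have "M \<otimes> N = cl (f \<boxtimes> g)" using f(2) g(2) by simp
  then show ?thesis unfolding mon_def using hom_Mult[OF f(1) g(1)] by blast
qed

lemma mon_prim [simp]:
  "mon (cl (idt A))" "mon (cl (\<sigma> A))" "mon (cl (\<sigma>i A))" "mon (cl (\<delta> A))" "mon (cl (\<delta>i A))"
  "mon (cl (br A B D))" "mon (cl (bl A B D))"
  unfolding mon_def by (metis hom_simps(1), metis hom_simps(2), metis hom_simps(3), metis hom_simps(4), metis hom_simps(5), metis hom_simps(6), metis hom_simps(7))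

text \<open>Mac Lane's normalising isomorphism with an accumulator: the factors of the first
  argument are absorbed into \<open>X\<close> one by one, the rightmost first.\<close>

primrec nrm :: "'p obj \<Rightarrow> 'p obj \<Rightarrow> 'p mterm set" where
  "nrm (Letter p) X = cl (idt (Letter p \<cdot> X))"
| "nrm Unit X = cl (\<sigma> X)"
| "nrm (A \<cdot> B) X = nrm A (app B X) \<bullet> (cl (idt A) \<otimes> nrm B X) \<bullet> cl (bl A B X)"

primrec nrm' :: "'p obj \<Rightarrow> 'p obj \<Rightarrow> 'p mterm set" where
  "nrm' (Letter p) X = cl (idt (Letter p \<cdot> X))"
| "nrm' Unit X = cl (\<sigma>i X)"
| "nrm' (A \<cdot> B) X = cl (br A B X) \<bullet> (cl (idt A) \<otimes> nrm' B X) \<bullet> nrm' A (app B X)"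

lemma mon_nrm: "mon (nrm A X) \<and> dom (nrm A X) = A \<cdot> X \<and> cod (nrm A X) = app A X"
  by (induction A arbitrary: X) auto

lemma mon_nrm': "mon (nrm' A X) \<and> dom (nrm' A X) = app A X \<and> cod (nrm' A X) = A \<cdot> X"
  by (induction A arbitrary: X) auto

lemmas nrm_simps [simp] = mon_nrm[THEN conjunct1] mon_nrm[THEN conjunct2, THEN conjunct1]
  mon_nrm[THEN conjunct2, THEN conjunct2] mon_nrm'[THEN conjunct1]
  mon_nrm'[THEN conjunct2, THEN conjunct1] mon_nrm'[THEN conjunct2, THEN conjunct2]

lemma nrm'_nrm: "nrm' A X \<bullet> nrm A X = cl (idt (A \<cdot> X))"
proof (induction A arbitrary: X)
  case (Prod A B)
  have "nrm' (A \<cdot> B) X \<bullet> nrm (A \<cdot> B) X = cl (br A B X) \<bullet> (cl (idt A) \<otimes> nrm' B X) \<bullet>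
    (nrm' A (app B X) \<bullet> nrm A (app B X)) \<bullet> (cl (idt A) \<otimes> nrm B X) \<bullet> cl (bl A B X)"
    by simp
  then show ?case by (simp add: Prod del: nrm.simps nrm'.simps)
qed auto

lemma bl_natural:
  assumes "valid M" "valid N" "valid P" "cod M = A" "cod N = B" "cod P = D"
  shows "cl (bl A B D) \<bullet> ((M \<otimes> N) \<otimes> P) = (M \<otimes> (N \<otimes> P)) \<bullet> cl (bl (dom M) (dom N) (dom P))"
proof -
  have "cl (bl A B D) \<bullet> ((M \<otimes> N) \<otimes> P) = cl (bl A B D) \<bullet> 
    (((M \<otimes> N) \<otimes> P) \<bullet> cl (br (dom M) (dom N) (dom P))) \<bullet> cl (bl (dom M) (dom N) (dom P))"
    using assms by simp
  then show ?thesis using assms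
    by (subst (asm) br_natural) simp_all
qed

lemma pentagon_bl: "cl (bl A B (D \<cdot> E)) \<bullet> cl (bl (A \<cdot> B) D E) \<bullet> (cl (br A B D) \<otimes> cl (idt E)) =
    (cl (idt A) \<otimes> cl (bl B D E)) \<bullet> cl (bl A (B \<cdot> D) E)"
proof -
  have "cl (bl A B (D \<cdot> E)) \<bullet> cl (bl (A \<cdot> B) D E) \<bullet> (cl (br A B D) \<otimes> cl (idt E)) =
    cl (bl A B (D \<cdot> E)) \<bullet> cl (bl (A \<cdot> B) D E) \<bullet> ((cl (br A B D) \<otimes> cl (idt E)) \<bullet>
    cl (br A (B \<cdot> D) E) \<bullet> (cl (idt A) \<otimes> cl (br B D E))) \<bullet> (cl (idt A) \<otimes> cl (bl B D E)) \<bullet> cl (bl A (B \<cdot> D) E)"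
    by simp
  then show ?thesis unfolding pentagon_cl[symmetric] by simp
qed

text \<open>Compatibility with normalisation passes from \<open>M\<close> to its inverse
  \<open>N\<close>, so that \<open>\<sigma>i\<close>, \<open>\<delta>i\<close> and \<open>bl\<close>
  need no calculation of their own.\<close>

lemma nrm_cong:
  assumes "valid M" "dom M = A" "cod M = B" "valid N" "dom N = B" "cod N = A" "M \<bullet> N = cl (idt B)"
    "app A X = app B X" "nrm B X \<bullet> (M \<otimes> cl (idt X)) = nrm A X"
  shows "nrm A X \<bullet> (N \<otimes> cl (idt X)) = nrm B X"
proof -
  have "nrm A X \<bullet> (N \<otimes> cl (idt X)) = nrm B X \<bullet> (M \<otimes> cl (idt X)) \<bullet> (N \<otimes> cl (idt X))"
    using assms(9) by (metis cmp_assoc)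
  then show ?thesis using assms by simp
qed

lemma nrm_sigma: "nrm A X \<bullet> (cl (\<sigma> A) \<otimes> cl (idt X)) = nrm (Unit \<cdot> A) X"
proof -
  have s: "cl (\<sigma> A) \<otimes> cl (idt X) = cl (\<sigma> (A \<cdot> X)) \<bullet> cl (bl Unit A X)"
    unfolding left_unit_assoc[symmetric] by simp
  show ?thesis
    using sigma_natural[of "nrm A X" "A \<cdot> X"] unfolding s by (simp flip: cmp_assoc)
qed

lemma nrm_delta: "nrm A X \<bullet> (cl (\<delta> A) \<otimes> cl (idt X)) = nrm (A \<cdot> Unit) X"
proof -
  have s: "cl (\<delta> A) \<otimes> cl (idt X) = (cl (idt A) \<otimes> cl (\<sigma> X)) \<bullet> cl (bl A Unit X)"
    unfolding triangle_cl[symmetric] by simp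
  show ?thesis unfolding s by simp
qed

lemma nrm_br: "nrm ((A \<cdot> B) \<cdot> D) X \<bullet> (cl (br A B D) \<otimes> cl (idt X)) = nrm (A \<cdot> (B \<cdot> D)) X"
proof -
  have "nrm ((A \<cdot> B) \<cdot> D) X \<bullet> (cl (br A B D) \<otimes> cl (idt X)) =
    nrm A (app B (app D X)) \<bullet> (cl (idt A) \<otimes> nrm B (app D X)) \<bullet>
      (cl (bl A B (app D X)) \<bullet> ((cl (idt A) \<otimes> cl (idt B)) \<otimes> nrm D X)) \<bullet>
      cl (bl (A \<cdot> B) D X) \<bullet> (cl (br A B D) \<otimes> cl (idt X))"
    by simp
  \<comment> \<open>\<open>nrm D X\<close> has to slide past the associator before the pentagon can
    be applied.\<close>
  also have "cl (bl A B (app D X)) \<bullet> ((cl (idt A) \<otimes> cl (idt B)) \<otimes> nrm D X) =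
      (cl (idt A) \<otimes> (cl (idt B) \<otimes> nrm D X)) \<bullet> cl (bl A B (D \<cdot> X))"
    by (subst bl_natural) simp_all
  finally show ?thesis
    by (simp add: pentagon_bl)
qed

text \<open>Normalisation turns every monoidal term into an identity. \<open>X\<close> stays
  arbitrary because in a product the left factor is normalised against \<open>app E X\<close>, not
  against \<open>X\<close>; the equality of the \<open>app\<close> values makes the equation well
  typed and has to be proved along with it.\<close>

lemma nrm_natural:
  assumes "hom Mon A B f"
  shows "app A X = app B X \<and> nrm B X \<bullet> (cl f \<otimes> cl (idt X)) = nrm A X"
  using assms
proof (induction arbitrary: X rule: hom.induct)
  case (hom_sigma A) then show ?case using nrm_sigma by simp
next
  case (hom_sigmai A)
  have "nrm (Unit \<cdot> A) X \<bullet> (cl (\<sigma>i A) \<otimes> cl (idt X)) = nrm (A) X"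
    by (rule nrm_cong[where M = "cl (\<sigma> A)"]) (simp_all add: nrm_sigma del: nrm.simps)
  then show ?case by simp
next
  case (hom_delta A) then show ?case using nrm_delta by simp
next
  case (hom_deltai A)
  have "nrm (A \<cdot> Unit) X \<bullet> (cl (\<delta>i A) \<otimes> cl (idt X)) = nrm (A) X"
    by (rule nrm_cong[where M = "cl (\<delta> A)"]) (simp_all add: nrm_delta del: nrm.simps)
  then show ?case by simp
next
  case (hom_br A B D) then show ?case using nrm_br by simp
next
  case (hom_bl A B D)
  have "nrm (A \<cdot> (B \<cdot> D)) X \<bullet> (cl (bl A B D) \<otimes> cl (idt X)) = nrm ((A \<cdot> B) \<cdot> D) X"
    by (rule nrm_cong[where M = "cl (br A B D)"]) (simp_all add: nrm_br del: nrm.simps)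
  then show ?case by simp
next
  case (hom_Comp A B f D g)
  have *: "valid (cl f)" "dom (cl f) = A" "cod (cl f) = B" "valid (cl g)" "dom (cl g) = B" "cod (cl g) = D"
    using hom_Comp.hyps cl_dom_cod hom_mono by blast+
  have "nrm D X \<bullet> (cl (g \<odot> f) \<otimes> cl (idt X)) = (nrm D X \<bullet> (cl g \<otimes> cl (idt X))) \<bullet> (cl f \<otimes> cl (idt X))"
    using * by simp
  then show ?case using hom_Comp.IH by simp
next
  case (hom_Mult A D f B E g)
  have *: "valid (cl f)" "dom (cl f) = A" "cod (cl f) = D" "valid (cl g)" "dom (cl g) = B" "cod (cl g) = E"
    using hom_Mult.hyps cl_dom_cod hom_mono by blast+
  have "nrm (D \<cdot> E) X \<bullet> (cl (f \<boxtimes> g) \<otimes> cl (idt X)) =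
    nrm D (app E X) \<bullet> (cl (idt D) \<otimes> nrm E X) \<bullet> cl (bl D E X) \<bullet> ((cl f \<otimes> cl g) \<otimes> cl (idt X))"
    by simp
  also have "cl (bl D E X) \<bullet> ((cl f \<otimes> cl g) \<otimes> cl (idt X)) = (cl f \<otimes> (cl g \<otimes> cl (idt X))) \<bullet> cl (bl A B X)"
    using * by (subst bl_natural) simp_all
  also have "nrm D (app E X) \<bullet> (cl (idt D) \<otimes> nrm E X) \<bullet> (cl f \<otimes> (cl g \<otimes> cl (idt X))) \<bullet> cl (bl A B X) =
    nrm D (app E X) \<bullet> (cl f \<otimes> cl (idt (app E X))) \<bullet> (cl (idt A) \<otimes> (nrm E X \<bullet> (cl g \<otimes> cl (idt X)))) \<bullet> cl (bl A B X)"
    using * hom_Mult.IH(2)[of X] by simp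
  also have "\<dots> = (nrm D (app E X) \<bullet> (cl f \<otimes> cl (idt (app E X)))) \<bullet> (cl (idt A) \<otimes> nrm B X) \<bullet> cl (bl A B X)"
    using hom_Mult.IH(2)[of X] by simp
  also have "\<dots> = nrm (A \<cdot> B) X"
    using hom_Mult.IH(1)[of "app E X"] hom_Mult.IH(2)[of X] by simp
  finally show ?case using hom_Mult.IH by simp
qed auto

lemma tns_Unit_cancel:
  assumes "valid M" "valid N" "dom M = dom N" "cod M = cod N" "M \<otimes> cl (idt Unit) = N \<otimes> cl (idt Unit)"
  shows "M = N"
proof -
  have "M \<bullet> cl (\<delta> (dom M)) \<bullet> cl (\<delta>i (dom M)) = N \<bullet> cl (\<delta> (dom M)) \<bullet> cl (\<delta>i (dom M))"
    using delta_natural assms by (metis cmp_assoc)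
  then show ?thesis using assms by simp
qed

text \<open>By \<open>nrm_natural\<close>, both morphisms become the same map after tensoring with
  \<open>Unit\<close> and normalising the target. The left inverse \<open>nrm'\<close> cancels the
  normalisation, and \<open>\<delta>\<close> cancels the unit.\<close>

theorem monoidal_coherence:
  assumes "mon M" "mon N" "dom M = dom N" "cod M = cod N"
  shows "M = N"
proof -
  have "nrm (cod M) Unit \<bullet> (M \<otimes> cl (idt Unit)) = nrm (dom M) Unit" if "mon M" for M
    using that nrm_natural by (metis monE)
  then have "nrm (cod M) Unit \<bullet> (M \<otimes> cl (idt Unit)) = nrm (cod M) Unit \<bullet> (N \<otimes> cl (idt Unit))"
    using assms by metis
  then have "(nrm' (cod M) Unit \<bullet> nrm (cod M) Unit) \<bullet> (M \<otimes> cl (idt Unit)) =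
      (nrm' (cod M) Unit \<bullet> nrm (cod M) Unit) \<bullet> (N \<otimes> cl (idt Unit))"
    by (metis cmp_assoc)
  then have "M \<otimes> cl (idt Unit) = N \<otimes> cl (idt Unit)"
    using assms by (simp add: nrm'_nrm)
  with tns_Unit_cancel[of M N] show ?thesis using assms by simp
qed

lemma mon_flat: "mon M \<Longrightarrow> flat (cod M) = flat (dom M)"
  using nrm_natural[of "dom M" "cod M" _ Unit] unfolding app_Unit by (metis monE flat_nested)

text \<open>Normalise \<open>A\<close>, then undo the normalisation of \<open>B\<close>; the two
  meet because \<open>flat A = flat B\<close> gives both the same right-nested form.\<close>

definition can :: "'p obj \<Rightarrow> 'p obj \<Rightarrow> 'p mterm set" where
  "can A B = cl (\<delta> B) \<bullet> nrm' B Unit \<bullet> nrm A Unit \<bullet> cl (\<delta>i A)"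

lemma can [simp]:
  assumes "flat A = flat B"
  shows "mon (can A B)" "dom (can A B) = A" "cod (can A B) = B"
  using assms unfolding can_def by (simp_all add: app_Unit)

lemma can_cmp: "flat A = flat B \<Longrightarrow> flat B = flat D \<Longrightarrow> can B D \<bullet> can A B = can A D"
  by (rule monoidal_coherence) simp_all

lemma can_self [simp]: "can A A = cl (idt A)"
  by (rule monoidal_coherence) simp_all

section \<open>Strictification\<close>

definition strict :: "'p mterm set \<Rightarrow> bool" where
  "strict M \<longleftrightarrow> valid M \<and> dom M = nested (flat (dom M)) \<and> cod M = nested (flat (cod M))"

definition dm :: "'p mterm set \<Rightarrow> 'p list" where
  "dm M = flat (dom M)"

definition cd :: "'p mterm set \<Rightarrow> 'p list" where
  "cd M = flat (cod M)"

definition strictify :: "'p mterm set \<Rightarrow> 'p mterm set" where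
  "strictify M = can (cod M) (nested (cd M)) \<bullet> M \<bullet> can (nested (dm M)) (dom M)"

definition Id :: "'p list \<Rightarrow> 'p mterm set" where
  "Id xs = cl (idt (nested xs))"

definition stns :: "'p mterm set \<Rightarrow> 'p mterm set \<Rightarrow> 'p mterm set"  (infixr "\<star>" 75) where
  "M \<star> N = strictify (M \<otimes> N)"

lemma strict_strictify: "valid M \<Longrightarrow> strict (strictify M) \<and> dm (strictify M) = dm M \<and> cd (strictify M) = cd M"
  unfolding strict_def strictify_def dm_def cd_def by simp

lemma strictify_strict: "strict M \<Longrightarrow> strictify M = M"
  unfolding strict_def strictify_def dm_def cd_def by (metis can_self cmp_idt idt_cmp)

lemma strict_valid: "strict M \<Longrightarrow> valid M"
  unfolding strict_def by blast

lemma strict_Id [simp]: "strict (Id xs)" "dm (Id xs) = xs" "cd (Id xs) = xs"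
  unfolding strict_def Id_def dm_def cd_def by simp_all

lemma strict_dom_cod:
  assumes "strict M" shows "dom M = nested (dm M)" "cod M = nested (cd M)"
  using assms unfolding strict_def dm_def cd_def by simp_all

lemma strict_cmp [simp]:
  assumes "strict M" "strict N" "cd M = dm N"
  shows "strict (N \<bullet> M)" "dm (N \<bullet> M) = dm M" "cd (N \<bullet> M) = cd N"
proof -
  have "cod M = dom N" using assms strict_dom_cod by metis
  then show "strict (N \<bullet> M)" "dm (N \<bullet> M) = dm M" "cd (N \<bullet> M) = cd N"
    using assms unfolding strict_def dm_def cd_def by simp_all
qed

lemma strict_stns [simp]:
  assumes "strict M" "strict N"
  shows "strict (M \<star> N)" "dm (M \<star> N) = dm M @ dm N" "cd (M \<star> N) = cd M @ cd N"
  using assms strict_strictify[of "M \<otimes> N"] unfolding stns_def by (simp_all add: strict_valid dm_def cd_def)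

lemma Id_cmp [simp]: "strict M \<Longrightarrow> cd M = xs \<Longrightarrow> Id xs \<bullet> M = M"
  and cmp_Id [simp]: "strict M \<Longrightarrow> dm M = xs \<Longrightarrow> M \<bullet> Id xs = M"
  unfolding Id_def by (auto simp: strict_dom_cod strict_valid)

lemma strictify_mon: "mon M \<Longrightarrow> strictify M = Id (dm M)"
  unfolding strictify_def Id_def dm_def cd_def
  by (rule monoidal_coherence) (simp_all add: mon_flat)

lemma strictify_cmp:
  assumes "valid M" "valid N" "cod M = dom N"
  shows "strictify (N \<bullet> M) = strictify N \<bullet> strictify M"
proof -
  have "strictify N \<bullet> strictify M = can (cod N) (nested (cd N)) \<bullet> N \<bullet> (can (nested (dm N)) (dom N) \<bullet>
      can (dom N) (nested (dm N))) \<bullet> M \<bullet> can (nested (dm M)) (dom M)"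
    using assms unfolding strictify_def cd_def dm_def by simp
  then show ?thesis
    using assms by (simp add: strictify_def cd_def dm_def can_cmp)
qed

text \<open>Monoidal morphisms strictify to identities, so in a commuting square with monoidal sides
  \<open>a\<close> and \<open>b\<close> the other two sides strictify equally. The strict unit and
  associativity laws of \<open>\<star>\<close> arise in this way.\<close>

lemma strictify_cong:
  assumes "valid M" "valid N" "mon a" "mon b" "cod a = dom N" "dom b = cod M" "dom a = dom M" "b \<bullet> M = N \<bullet> a"
  shows "strictify M = strictify N"
proof -
  have "strictify b \<bullet> strictify M = strictify N \<bullet> strictify a" using assms strictify_cmp by (metis mon_valid)
  moreover have "dm b = cd M" "dm a = dm N" 
    using assms mon_flat[of a] unfolding dm_def cd_def by metis+
  ultimately show ?thesis
    using assms(1-4) by (simp add: strictify_mon strict_strictify)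
qed

lemma strictify_can: "valid M \<Longrightarrow> strictify M \<bullet> can (dom M) (nested (dm M)) = can (cod M) (nested (cd M)) \<bullet> M"
  unfolding strictify_def dm_def cd_def by (simp add: can_cmp)

lemma strictify_tns:
  assumes "valid M" "valid N"
  shows "strictify (M \<otimes> N) = strictify M \<star> strictify N"
proof -
  have *: "valid (strictify M)" "valid (strictify N)" "dom (strictify M) = nested (dm M)" "dom (strictify N) = nested (dm N)"
    using assms by (simp_all add: strict_strictify strict_valid strict_dom_cod)
  show ?thesis unfolding stns_def
    by (rule strictify_cong[where a = "can (dom M) (nested (dm M)) \<otimes> can (dom N) (nested (dm N))"
        and b = "can (cod M) (nested (cd M)) \<otimes> can (cod N) (nested (cd N))"])
      (use assms * strictify_can[OF assms(1)] strictify_can[OF assms(2)] in \<open>simp_all add: dm_def cd_def\<close>)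
qed

lemma stns_assoc [simp]:
  assumes "strict M" "strict N" "strict P"
  shows "(M \<star> N) \<star> P = M \<star> (N \<star> P)"
proof -
  have "(M \<star> N) \<star> P = strictify ((M \<otimes> N) \<otimes> P)" "M \<star> (N \<star> P) = strictify (M \<otimes> (N \<otimes> P))"
    using assms by (simp_all add: strictify_tns strictify_strict strict_valid)
  moreover have "strictify (M \<otimes> (N \<otimes> P)) = strictify ((M \<otimes> N) \<otimes> P)"
    by (rule strictify_cong[where a = "cl (br (dom M) (dom N) (dom P))" and b = "cl (br (cod M) (cod N) (cod P))"])
      (use assms br_natural[of M N P] in \<open>simp_all add: strict_valid\<close>)
  ultimately show ?thesis by simp
qed

lemma Id_Nil_stns [simp]:
  assumes "strict M" shows "Id [] \<star> M = M"
proof -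
  have "strictify (cl (idt Unit) \<otimes> M) = strictify M"
    by (rule strictify_cong[where a = "cl (\<sigma> (dom M))" and b = "cl (\<sigma> (cod M))"])
      (use assms sigma_natural[of M] in \<open>simp_all add: strict_valid\<close>)
  then show ?thesis using assms by (simp add: stns_def Id_def strictify_strict)
qed

lemma stns_Id_Nil [simp]:
  assumes "strict M" shows "M \<star> Id [] = M"
proof -
  have "strictify (M \<otimes> cl (idt Unit)) = strictify M"
    by (rule strictify_cong[where a = "cl (\<delta> (dom M))" and b = "cl (\<delta> (cod M))"])
      (use assms delta_natural[of M] in \<open>simp_all add: strict_valid\<close>)
  then show ?thesis using assms by (simp add: stns_def Id_def strictify_strict)
qed

lemma Id_stns [simp]: "Id xs \<star> Id ys = Id (xs @ ys)"
  unfolding stns_def using strictify_mon[of "Id xs \<otimes> Id ys"] by (simp add: Id_def dm_def)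

lemma stns_cmp:
  assumes "strict M" "strict N" "strict P" "strict Q" "cd M = dm P" "cd N = dm Q"
  shows "(P \<star> Q) \<bullet> (M \<star> N) = (P \<bullet> M) \<star> (Q \<bullet> N)"
proof -
  have "cod M = dom P" "cod N = dom Q" using assms by (simp_all add: strict_dom_cod)
  then show ?thesis using assms unfolding stns_def
    by (simp add: strict_valid flip: strictify_cmp)
qed

section \<open>Symmetry, diagonal and discarding on words\<close>

definition has_c :: bool where "has_c \<longleftrightarrow> C \<in> {SyMon, Rel, Aff, Cart}"
definition has_w :: bool where "has_w \<longleftrightarrow> C \<in> {Rel, Cart}"
definition has_k :: bool where "has_k \<longleftrightarrow> C \<in> {Aff, Cart}"

lemma has_D: "has_c \<Longrightarrow> C \<in> {SyMon, Rel, Aff, Cart}" "has_w \<Longrightarrow> C \<in> {Rel, Cart}"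
    "has_k \<Longrightarrow> C \<in> {Aff, Cart}" "has_w \<Longrightarrow> has_k \<Longrightarrow> C = Cart"
  unfolding has_c_def has_w_def has_k_def by auto

lemma has_w_c: "has_w \<Longrightarrow> has_c" and has_k_c: "has_k \<Longrightarrow> has_c"
  unfolding has_c_def has_w_def has_k_def by auto

definition cc :: "'p list \<Rightarrow> 'p list \<Rightarrow> 'p mterm set" where
  "cc xs ys = strictify (cl (c (nested xs) (nested ys)))"

definition ww :: "'p list \<Rightarrow> 'p mterm set" where
  "ww xs = strictify (cl (w (nested xs)))"

definition kk :: "'p list \<Rightarrow> 'p mterm set" where
  "kk xs = strictify (cl (k (nested xs)))"

lemma prim_cwk [simp]:
  "has_c \<Longrightarrow> valid (cl (c A B))" "has_c \<Longrightarrow> dom (cl (c A B)) = A \<cdot> B" "has_c \<Longrightarrow> cod (cl (c A B)) = B \<cdot> A"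
  "has_w \<Longrightarrow> valid (cl (w A))" "has_w \<Longrightarrow> dom (cl (w A)) = A" "has_w \<Longrightarrow> cod (cl (w A)) = A \<cdot> A"
  "has_k \<Longrightarrow> valid (cl (k A))" "has_k \<Longrightarrow> dom (cl (k A)) = A" "has_k \<Longrightarrow> cod (cl (k A)) = Unit"
  unfolding has_c_def has_w_def has_k_def
  by (simp_all add: cl_dom_cod[OF hom_c] cl_dom_cod[OF hom_w] cl_dom_cod[OF hom_k])

lemma c_natural:
  assumes "has_c" "valid M" "valid N"
  shows "(N \<otimes> M) \<bullet> cl (c (dom M) (dom N)) = cl (c (cod M) (cod N)) \<bullet> (M \<otimes> N)"
proof -
  obtain f g where *: "hom C (dom M) (cod M) f" "M = cl f" "hom C (dom N) (cod N) g" "N = cl g"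
    using validE[OF assms(2)] validE[OF assms(3)] by metis
  then show ?thesis using cl_eqI[OF c_nat[OF _ *(1,3)]] assms(1) * by (simp add: has_c_def)
qed

lemma w_natural:
  assumes "has_w" "valid M"
  shows "(M \<otimes> M) \<bullet> cl (w (dom M)) = cl (w (cod M)) \<bullet> M"
proof -
  obtain f where *: "hom C (dom M) (cod M) f" "M = cl f" using validE[OF assms(2)] by metis
  then show ?thesis using cl_eqI[OF w_nat[OF _ *(1)]] assms(1) * by (simp add: has_w_def)
qed

lemma k_natural:
  assumes "has_k" "valid M"
  shows "cl (k (dom M)) = cl (k (cod M)) \<bullet> M"
proof -
  obtain f where *: "hom C (dom M) (cod M) f" "M = cl f" using validE[OF assms(2)] by metis
  then show ?thesis using cl_eqI[OF k_nat[OF _ *(1)]] assms(1) * by (simp add: has_k_def)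
qed

text \<open>Naturality along the canonical isomorphisms makes the strictified generator depend only
  on the words of its objects.\<close>

lemma strictify_c: "has_c \<Longrightarrow> strictify (cl (c A B)) = cc (flat A) (flat B)"
  unfolding cc_def
  by (rule strictify_cong[where a = "can A (nested (flat A)) \<otimes> can B (nested (flat B))"
        and b = "can B (nested (flat B)) \<otimes> can A (nested (flat A))"])
    (use c_natural[of "can A (nested (flat A))" "can B (nested (flat B))"] in simp_all)

lemma strictify_w: "has_w \<Longrightarrow> strictify (cl (w A)) = ww (flat A)"
  unfolding ww_def
  by (rule strictify_cong[where a = "can A (nested (flat A))"
        and b = "can A (nested (flat A)) \<otimes> can A (nested (flat A))"])
    (use w_natural[of "can A (nested (flat A))"] in simp_all)

lemma strictify_k: "has_k \<Longrightarrow> strictify (cl (k A)) = kk (flat A)"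
  unfolding kk_def
  by (rule strictify_cong[where a = "can A (nested (flat A))" and b = "cl (idt Unit)"])
    (use k_natural[of "can A (nested (flat A))"] in simp_all)

lemma strict_cc [simp]:
  assumes "has_c" shows "strict (cc xs ys)" "dm (cc xs ys) = xs @ ys" "cd (cc xs ys) = ys @ xs"
  using strict_strictify[of "cl (c (nested xs) (nested ys))"] assms unfolding cc_def
  by (simp_all add: dm_def cd_def)

lemma strict_ww [simp]:
  assumes "has_w" shows "strict (ww xs)" "dm (ww xs) = xs" "cd (ww xs) = xs @ xs"
  using strict_strictify[of "cl (w (nested xs))"] assms unfolding ww_def
  by (simp_all add: dm_def cd_def)

lemma strict_kk [simp]:
  assumes "has_k" shows "strict (kk xs)" "dm (kk xs) = xs" "cd (kk xs) = []"
  using strict_strictify[of "cl (k (nested xs))"] assms unfolding kk_def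
  by (simp_all add: dm_def cd_def)

lemma cc_natural:
  assumes "has_c" "strict M" "strict N"
  shows "(N \<star> M) \<bullet> cc (dm M) (dm N) = cc (cd M) (cd N) \<bullet> (M \<star> N)"
  using arg_cong[OF c_natural[of M N], of strictify] assms
  by (simp add: strictify_cmp strict_valid strictify_c strictify_tns strictify_strict dm_def cd_def)

lemma ww_natural:
  assumes "has_w" "strict M"
  shows "(M \<star> M) \<bullet> ww (dm M) = ww (cd M) \<bullet> M"
  using arg_cong[OF w_natural[of M], of strictify] assms
  by (simp add: strictify_cmp strict_valid strictify_w strictify_tns strictify_strict dm_def cd_def)

lemma kk_natural:
  assumes "has_k" "strict M"
  shows "kk (cd M) \<bullet> M = kk (dm M)"
  using arg_cong[OF k_natural[of M], of strictify] assms
  by (simp add: strictify_cmp strict_valid strictify_k strictify_strict dm_def cd_def)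

lemma strictify_prim [simp]:
  "strictify (cl (idt A)) = Id (flat A)" "strictify (cl (\<sigma> A)) = Id (flat A)" "strictify (cl (\<delta> A)) = Id (flat A)"
  "strictify (cl (\<sigma>i A)) = Id (flat A)" "strictify (cl (\<delta>i A)) = Id (flat A)"
  "strictify (cl (br A B D)) = Id (flat A @ flat B @ flat D)" "strictify (cl (bl A B D)) = Id (flat A @ flat B @ flat D)"
  by (simp_all add: strictify_mon dm_def)

lemma cc_cc:
  assumes "has_c" shows "cc ys xs \<bullet> cc xs ys = Id (xs @ ys)"
  using arg_cong[OF cl_eqI[OF c_c[of C "nested xs" "nested ys", OF has_D(1)[OF assms]]], of strictify] assms
  by (simp add: strictify_cmp strictify_c)

lemma cc_Nil_right [simp]:
  assumes "has_c" shows "cc xs [] = Id xs"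
  using arg_cong[OF cl_eqI[OF sigma_c[of C "nested xs", OF has_D(1)[OF assms]]], of strictify] assms
  by (simp add: strictify_cmp strictify_c)

lemma cc_Nil_left [simp]:
  assumes "has_c" shows "cc [] xs = Id xs"
  using cc_cc[of xs "[]"] assms by simp

lemma cc_append_left:
  assumes "has_c"
  shows "cc (xs @ ys) zs = (cc xs zs \<star> Id ys) \<bullet> (Id xs \<star> cc ys zs)"
  using arg_cong[OF cl_eqI[OF hexagon[of C "nested xs" "nested ys" "nested zs", OF has_D(1)[OF assms]]], of strictify] assms
  by (simp add: strictify_cmp strictify_c strictify_tns)

text \<open>The hexagon splits the first argument only. Splitting the second follows by inverting,
  as \<open>cc ys xs\<close> is inverse to \<open>cc xs ys\<close>.\<close>

lemma cc_append_right:
  assumes "has_c"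
  shows "cc xs (ys @ zs) = (Id ys \<star> cc xs zs) \<bullet> (cc xs ys \<star> Id zs)"
proof -
  have "cc (ys @ zs) xs \<bullet> (Id ys \<star> cc xs zs) \<bullet> (cc xs ys \<star> Id zs) = Id (xs @ ys @ zs)"
    using assms
    by (simp add: cc_append_left stns_cmp cc_cc flip: cmp_assoc)
      (simp add: stns_cmp cc_cc)
  then have "cc xs (ys @ zs) \<bullet> cc (ys @ zs) xs \<bullet> (Id ys \<star> cc xs zs) \<bullet> (cc xs ys \<star> Id zs) = cc xs (ys @ zs)"
    using assms by simp
  then show ?thesis
    using assms by (simp add: cc_cc flip: cmp_assoc)
qed

lemma ww_Nil:
  assumes "has_w" shows "ww [] = Id []"
  using arg_cong[OF cl_eqI[OF w_Unit[of C, OF has_D(2)[OF assms]]], of strictify] assms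
  by (simp add: strictify_cmp strictify_w)

lemma ww_assoc:
  assumes "has_w" shows "(Id xs \<star> ww xs) \<bullet> ww xs = (ww xs \<star> Id xs) \<bullet> ww xs"
  using arg_cong[OF cl_eqI[OF w_assoc[of C "nested xs", OF has_D(2)[OF assms]]], of strictify] assms
  by (simp add: strictify_cmp strictify_w strictify_tns)

lemma cc_ww:
  assumes "has_w" shows "cc xs xs \<bullet> ww xs = ww xs"
  using arg_cong[OF cl_eqI[OF c_w[of C "nested xs", OF has_D(2)[OF assms]]], of strictify] assms
  by (simp add: strictify_cmp strictify_w strictify_c has_w_c)

lemma cm_ww:
  assumes "has_w" shows "(Id xs \<star> cc ys xs \<star> Id ys) \<bullet> ww (xs @ ys) = ww xs \<star> ww ys"
  using arg_cong[OF cl_eqI[OF cm_w[of C "nested xs" "nested ys", OF has_D(2)[OF assms]]], of strictify] assms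
  by (simp add: cm_def strictify_cmp strictify_w strictify_c strictify_tns has_w_c)

lemma kk_Nil:
  assumes "has_k" shows "kk [] = Id []"
  using arg_cong[OF cl_eqI[OF k_Unit[of C, OF has_D(3)[OF assms]]], of strictify] assms
  by (simp add: strictify_k)

lemma kk_ww_left:
  assumes "has_w" "has_k" shows "(kk xs \<star> Id xs) \<bullet> ww xs = Id xs"
  using arg_cong[OF cl_eqI[OF sigma_k_w[of C "nested xs", OF has_D(4)[OF assms]]], of strictify] assms
  by (simp add: strictify_cmp strictify_k strictify_w strictify_tns)

lemma kk_ww_right:
  assumes "has_w" "has_k" shows "(Id xs \<star> kk xs) \<bullet> ww xs = Id xs"
  using arg_cong[OF cl_eqI[OF delta_k_w[of C "nested xs", OF has_D(4)[OF assms]]], of strictify] assms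
  by (simp add: strictify_cmp strictify_k strictify_w strictify_tns)

text \<open>A term representing a strict morphism may pass through arbitrary objects. Strictifying
  it constructor by constructor keeps every intermediate morphism strict, which turns induction over
  terms into induction inside the strict category.\<close>

lemma strict_induct [consumes 1, case_names Id cc ww kk cmp stns]:
  assumes M: "strict M"
    and Id: "\<And>xs. P (Id xs)"
    and cc: "\<And>xs ys. has_c \<Longrightarrow> P (cc xs ys)"
    and ww: "\<And>xs. has_w \<Longrightarrow> P (ww xs)"
    and kk: "\<And>xs. has_k \<Longrightarrow> P (kk xs)"
    and cmp: "\<And>M N. strict M \<Longrightarrow> strict N \<Longrightarrow> cd M = dm N \<Longrightarrow> P M \<Longrightarrow> P N \<Longrightarrow> P (N \<bullet> M)"
    and stns: "\<And>M N. strict M \<Longrightarrow> strict N \<Longrightarrow> P M \<Longrightarrow> P N \<Longrightarrow> P (M \<star> N)"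
  shows "P M"
proof -
  obtain f where f: "hom C (dom M) (cod M) f" "M = cl f" using strict_valid[OF M] by (rule validE)
  have "P (strictify (cl f))" using f(1)
  proof (induction rule: hom.induct)
    case (hom_Comp A B f D g)
    have *: "valid (cl f)" "cod (cl f) = B" "valid (cl g)" "dom (cl g) = B"
      using hom_Comp.hyps cl_dom_cod by blast+
    then have "cd (cl f) = dm (cl g)" by (simp add: dm_def cd_def)
    with * have "P (strictify (cl g) \<bullet> strictify (cl f))"
      using hom_Comp.IH by (intro cmp) (simp_all add: strict_strictify)
    then show ?case using * by (simp add: strictify_cmp)
  next
    case (hom_Mult A D f B E g)
    have *: "valid (cl f)" "valid (cl g)"
      using hom_Mult.hyps cl_dom_cod by blast+
    then have "P (strictify (cl f) \<star> strictify (cl g))"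
      using hom_Mult.IH by (intro stns) (simp_all add: strict_strictify)
    then show ?case using * by (simp add: strictify_tns)
  next
    case (hom_c A B) then show ?case using cc strictify_c has_c_def by metis
  next
    case (hom_w A) then show ?case using ww strictify_w has_w_def by metis
  next
    case (hom_k A) then show ?case using kk strictify_k has_k_def by metis
  qed (use Id in simp_all)
  then show ?thesis using f(2) strictify_strict[OF M] by simp
qed

section \<open>Coherence for words without repetitions\<close>

lemma Id_stns' [simp]: "strict M \<Longrightarrow> Id xs \<star> (Id ys \<star> M) = Id (xs @ ys) \<star> M"
  by (simp flip: stns_assoc)

lemma Id_stns_cmp: "strict M \<Longrightarrow> strict N \<Longrightarrow> cd M = dm N \<Longrightarrow> Id xs \<star> (N \<bullet> M) = (Id xs \<star> N) \<bullet> (Id xs \<star> M)"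
  by (simp add: stns_cmp)

lemma cmp_stns_Id: "strict M \<Longrightarrow> strict N \<Longrightarrow> cd M = dm N \<Longrightarrow> (N \<bullet> M) \<star> Id xs = (N \<star> Id xs) \<bullet> (M \<star> Id xs)"
  by (simp add: stns_cmp)

lemma stns_exchange:
  assumes "strict M" "strict N"
  shows "(M \<star> Id (cd N)) \<bullet> (Id (dm M) \<star> N) = M \<star> N"
    and "(Id (cd M) \<star> N) \<bullet> (M \<star> Id (dm N)) = M \<star> N"
  using assms by (simp_all add: stns_cmp)

lemma cmp_cong_left: "N \<bullet> M = P \<Longrightarrow> N \<bullet> M \<bullet> R = P \<bullet> R"
  by (metis cmp_assoc)

section \<open>Unshuffling a word by a predicate on letters\<close>

primrec unshuffle :: "('p \<Rightarrow> bool) \<Rightarrow> 'p list \<Rightarrow> 'p mterm set" where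
  "unshuffle Q [] = Id []"
| "unshuffle Q (x # xs) = (if Q x then Id [x] \<star> unshuffle Q xs
    else (cc [x] (filter Q xs) \<star> Id [x \<leftarrow> xs. \<not> Q x]) \<bullet> (Id [x] \<star> unshuffle Q xs))"

lemma strict_unshuffle [simp]:
  assumes "has_c"
  shows "strict (unshuffle Q xs)" "dm (unshuffle Q xs) = xs" "cd (unshuffle Q xs) = filter Q xs @ [x \<leftarrow> xs. \<not> Q x]"
proof -
  have "strict (unshuffle Q xs) \<and> dm (unshuffle Q xs) = xs \<and> cd (unshuffle Q xs) = filter Q xs @ [x \<leftarrow> xs. \<not> Q x]"
    using assms by (induction xs) auto
  then show "strict (unshuffle Q xs)" "dm (unshuffle Q xs) = xs" "cd (unshuffle Q xs) = filter Q xs @ [x \<leftarrow> xs. \<not> Q x]"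
    by auto
qed

lemma unshuffle_left_inverse:
  assumes "has_c"
  shows "\<exists>N. strict N \<and> dm N = filter Q xs @ [x \<leftarrow> xs. \<not> Q x] \<and> cd N = xs \<and> N \<bullet> unshuffle Q xs = Id xs"
proof (induction xs)
  case Nil
  then show ?case by (intro exI[of _ "Id []"]) simp
next
  case (Cons x xs)
  then obtain N where N: "strict N" "dm N = filter Q xs @ [x \<leftarrow> xs. \<not> Q x]" "cd N = xs" "N \<bullet> unshuffle Q xs = Id xs"
    by blast
  show ?case
  proof (cases "Q x")
    case True
    then show ?thesis using N assms by (intro exI[of _ "Id [x] \<star> N"]) (simp add: stns_cmp)
  next
    case False
    have "(cc (filter Q xs) [x] \<star> Id [x \<leftarrow> xs. \<not> Q x]) \<bullet> (cc [x] (filter Q xs) \<star> Id [x \<leftarrow> xs. \<not> Q x]) \<bullet> (Id [x] \<star> unshuffle Q xs)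
      = Id [x] \<star> unshuffle Q xs"
      using assms by (simp add: stns_cmp cc_cc flip: cmp_assoc)
    then show ?thesis using N False assms
      by (intro exI[of _ "(Id [x] \<star> N) \<bullet> (cc (filter Q xs) [x] \<star> Id [x \<leftarrow> xs. \<not> Q x])"])
        (simp add: stns_cmp)
  qed
qed

text \<open>Once both halves are sorted, the word consists of four blocks, alternately satisfying
  and violating \<open>Q\<close>, and only the middle two remain to be exchanged.\<close>

lemma unshuffle_append:
  assumes "has_c"
  shows "unshuffle Q (xs @ ys) = (Id (filter Q xs) \<star> cc [x \<leftarrow> xs. \<not> Q x] (filter Q ys) \<star> Id [y \<leftarrow> ys. \<not> Q y])
    \<bullet> (unshuffle Q xs \<star> unshuffle Q ys)"
proof (induction xs)
  case Nil
  then show ?case using assms by simp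
next
  case (Cons x xs)
  let ?X = "filter Q xs" and ?X' = "[x \<leftarrow> xs. \<not> Q x]" and ?Y = "filter Q ys" and ?Y' = "[x \<leftarrow> ys. \<not> Q x]"
  show ?case
  proof (cases "Q x")
    case True
    then show ?thesis using assms Cons by (simp add: Id_stns_cmp)
  next
    case False
    have "unshuffle Q ((x # xs) @ ys) = (((Id ?X \<star> cc [x] ?Y) \<bullet> (cc [x] ?X \<star> Id ?Y)) \<star> Id (?X' @ ?Y'))
       \<bullet> (Id [x] \<star> ((Id ?X \<star> cc ?X' ?Y \<star> Id ?Y') \<bullet> (unshuffle Q xs \<star> unshuffle Q ys)))"
      using False assms Cons by (simp add: cc_append_right)
    also have "\<dots> = (Id ?X \<star> cc [x] ?Y \<star> Id (?X' @ ?Y')) \<bullet> ((cc [x] ?X \<star> Id (?Y @ ?X' @ ?Y'))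
       \<bullet> (Id (x # ?X) \<star> (cc ?X' ?Y \<star> Id ?Y'))) \<bullet> (Id [x] \<star> unshuffle Q xs \<star> unshuffle Q ys)"
      using assms by (simp add: Id_stns_cmp cmp_stns_Id)
    \<comment> \<open>The exchanges of \<open>x\<close> with \<open>?X\<close> and of
      \<open>?X'\<close> with \<open>?Y\<close> act on disjoint stretches of the word, so they
      commute. This brings together the two exchanges with \<open>?Y\<close>, which then merge into
      that of \<open>x # ?X'\<close>.\<close>
    also have "(cc [x] ?X \<star> Id (?Y @ ?X' @ ?Y')) \<bullet> (Id (x # ?X) \<star> (cc ?X' ?Y \<star> Id ?Y')) =
        (Id (?X @ [x]) \<star> (cc ?X' ?Y \<star> Id ?Y')) \<bullet> (cc [x] ?X \<star> Id (?X' @ ?Y @ ?Y'))"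
      using assms stns_exchange[of "cc [x] ?X" "cc ?X' ?Y \<star> Id ?Y'"] by simp
    also have "(Id ?X \<star> cc [x] ?Y \<star> Id (?X' @ ?Y')) \<bullet> ((Id (?X @ [x]) \<star> (cc ?X' ?Y \<star> Id ?Y'))
         \<bullet> (cc [x] ?X \<star> Id (?X' @ ?Y @ ?Y'))) \<bullet> (Id [x] \<star> unshuffle Q xs \<star> unshuffle Q ys) =
        (Id ?X \<star> ((cc [x] ?Y \<star> Id ?X') \<bullet> (Id [x] \<star> cc ?X' ?Y)) \<star> Id ?Y') \<bullet>
        (((cc [x] ?X \<star> Id ?X') \<bullet> (Id [x] \<star> unshuffle Q xs)) \<star> unshuffle Q ys)"
    proof -
      have "((cc [x] ?X \<star> Id ?X') \<bullet> (Id [x] \<star> unshuffle Q xs)) \<star> (Id (?Y @ ?Y') \<bullet> unshuffle Q ys) =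
        (cc [x] ?X \<star> Id (?X' @ ?Y @ ?Y')) \<bullet> (Id [x] \<star> unshuffle Q xs \<star> unshuffle Q ys)"
        using assms by (subst stns_cmp[symmetric]) simp_all
      then show ?thesis
        using assms by (simp add: Id_stns_cmp cmp_stns_Id)
    qed
    finally show ?thesis
      using False assms cc_append_left[of "[x]" ?X' ?Y] by simp
  qed
qed

text \<open>Splitting both arguments of the symmetry gives four block crossings; the one of
  \<open>xs\<close> with \<open>ys'\<close> is undone by the leading
  \<open>cc ys' xs\<close>.\<close>

lemma middle_cc:
  assumes "has_c"
  shows "(Id ys \<star> cc ys' xs \<star> Id xs') \<bullet> cc (xs @ xs') (ys @ ys') =
    (cc xs ys \<star> cc xs' ys') \<bullet> (Id xs \<star> cc xs' ys \<star> Id ys')"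
proof -
  have "(Id ys \<star> cc ys' xs \<star> Id xs') \<bullet> cc (xs @ xs') (ys @ ys') =
    (Id ys \<star> (cc ys' xs \<bullet> cc xs ys') \<star> Id xs') \<bullet> ((Id (ys @ xs) \<star> cc xs' ys') \<bullet>
     (cc xs ys \<star> Id (xs' @ ys'))) \<bullet> (Id xs \<star> cc xs' ys \<star> Id ys')"
    using assms by (simp add: cc_append_left cc_append_right Id_stns_cmp cmp_stns_Id)
  also have "(Id (ys @ xs) \<star> cc xs' ys') \<bullet> (cc xs ys \<star> Id (xs' @ ys')) = cc xs ys \<star> cc xs' ys'"
    using assms stns_exchange[of "cc xs ys" "cc xs' ys'"] by simp
  finally show ?thesis using assms by (simp add: cc_cc)
qed

lemma middle_natural:
  assumes "has_c" "strict M" "strict M'" "strict N" "strict N'"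
  shows "(Id (cd M) \<star> cc (cd M') (cd N) \<star> Id (cd N')) \<bullet> ((M \<star> M') \<star> (N \<star> N')) =
    ((M \<star> N) \<star> (M' \<star> N')) \<bullet> (Id (dm M) \<star> cc (dm M') (dm N) \<star> Id (dm N'))"
  using assms cc_natural[of M' N] by (simp add: stns_cmp) (simp flip: stns_assoc add: stns_cmp)

text \<open>Conjugated by unshuffles, \<open>M\<close> falls apart into a part on the letters
  satisfying \<open>Q\<close> and a part on the others. This is a relation because the parts are
  found by induction on how \<open>M\<close> is generated.\<close>

definition splits :: "('p \<Rightarrow> bool) \<Rightarrow> 'p mterm set \<Rightarrow> 'p mterm set \<Rightarrow> 'p mterm set \<Rightarrow> bool" where
  "splits Q M M1 M2 \<longleftrightarrow> strict M1 \<and> strict M2 \<and>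
    dm M1 = filter Q (dm M) \<and> cd M1 = filter Q (cd M) \<and>
    dm M2 = [x \<leftarrow> dm M. \<not> Q x] \<and> cd M2 = [x \<leftarrow> cd M. \<not> Q x] \<and>
    unshuffle Q (cd M) \<bullet> M = (M1 \<star> M2) \<bullet> unshuffle Q (dm M)"

lemma unshuffle_natural:
  assumes "strict M" "has_c"
  shows "\<exists>M1 M2. splits Q M M1 M2"
  using assms(1)
proof (induction rule: strict_induct)
  case (Id xs)
  show ?case
    by (intro exI[of _ "Id (filter Q xs)"] exI[of _ "Id [x \<leftarrow> xs. \<not> Q x]"])
      (use assms in \<open>simp add: splits_def\<close>)
next
  case (cc xs ys)
  let ?F = "filter Q" and ?G = "filter (\<lambda>x. \<not> Q x)"
  have "unshuffle Q (ys @ xs) \<bullet> cc xs ys = (Id (?F ys) \<star> cc (?G ys) (?F xs) \<star> Id (?G xs)) \<bullet>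
      (unshuffle Q ys \<star> unshuffle Q xs) \<bullet> cc xs ys"
    using assms by (simp add: unshuffle_append)
  also have "(unshuffle Q ys \<star> unshuffle Q xs) \<bullet> cc xs ys = cc (?F xs @ ?G xs) (?F ys @ ?G ys) \<bullet> (unshuffle Q xs \<star> unshuffle Q ys)"
    using cc_natural[of "unshuffle Q xs" "unshuffle Q ys"] assms by simp
  also have "(Id (?F ys) \<star> cc (?G ys) (?F xs) \<star> Id (?G xs)) \<bullet> \<dots> =
      (cc (?F xs) (?F ys) \<star> cc (?G xs) (?G ys)) \<bullet> unshuffle Q (xs @ ys)"
    using cmp_cong_left[OF middle_cc] assms by (simp add: unshuffle_append)
  finally show ?case
    by (intro exI[of _ "cc (?F xs) (?F ys)"] exI[of _ "cc (?G xs) (?G ys)"])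
      (use assms in \<open>simp add: splits_def\<close>)
next
  case (ww xs)
  let ?F = "filter Q" and ?G = "filter (\<lambda>x. \<not> Q x)"
  have "unshuffle Q (xs @ xs) \<bullet> ww xs = (Id (?F xs) \<star> cc (?G xs) (?F xs) \<star> Id (?G xs)) \<bullet>
      (unshuffle Q xs \<star> unshuffle Q xs) \<bullet> ww xs"
    using assms by (simp add: unshuffle_append)
  also have "(unshuffle Q xs \<star> unshuffle Q xs) \<bullet> ww xs = ww (?F xs @ ?G xs) \<bullet> unshuffle Q xs"
    using ww_natural[of "unshuffle Q xs"] assms ww by simp
  also have "(Id (?F xs) \<star> cc (?G xs) (?F xs) \<star> Id (?G xs)) \<bullet> \<dots> =
      (ww (?F xs) \<star> ww (?G xs)) \<bullet> unshuffle Q xs"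
    using cmp_cong_left[OF cm_ww] ww by simp
  finally show ?case
    by (intro exI[of _ "ww (?F xs)"] exI[of _ "ww (?G xs)"])
      (use assms ww in \<open>simp add: splits_def\<close>)
next
  case (kk xs)
  let ?F = "filter Q" and ?G = "filter (\<lambda>x. \<not> Q x)"
  \<comment> \<open>By naturality and \<open>kk_Nil\<close>, every strict morphism to the empty word
    is \<open>kk\<close> of its source.\<close>
  have "(kk (?F xs) \<star> kk (?G xs)) \<bullet> unshuffle Q xs = kk xs"
    using assms kk kk_natural[of "(kk (?F xs) \<star> kk (?G xs)) \<bullet> unshuffle Q xs"] by (simp add: kk_Nil)
  then show ?case
    by (intro exI[of _ "kk (?F xs)"] exI[of _ "kk (?G xs)"])
      (use assms kk in \<open>simp add: splits_def\<close>)
next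
  case (cmp M N)
  then obtain M1 M2 N1 N2 where *: "splits Q M M1 M2" "splits Q N N1 N2" by blast
  have "unshuffle Q (cd N) \<bullet> N \<bullet> M = (N1 \<star> N2) \<bullet> unshuffle Q (dm N) \<bullet> M"
    using * by (metis splits_def cmp_assoc)
  also have "unshuffle Q (dm N) \<bullet> M = (M1 \<star> M2) \<bullet> unshuffle Q (dm M)"
    using * cmp by (metis splits_def)
  also have "(N1 \<star> N2) \<bullet> (M1 \<star> M2) \<bullet> unshuffle Q (dm M) = ((N1 \<bullet> M1) \<star> (N2 \<bullet> M2)) \<bullet> unshuffle Q (dm M)"
    using * cmp by (intro cmp_cong_left stns_cmp) (simp_all add: splits_def)
  finally have "splits Q (N \<bullet> M) (N1 \<bullet> M1) (N2 \<bullet> M2)"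
    using * cmp by (simp add: splits_def)
  then show ?case by blast
next
  case (stns M N)
  then obtain M1 M2 N1 N2 where *: "splits Q M M1 M2" "splits Q N N1 N2" by blast
  then have s: "strict M1" "strict M2" "strict N1" "strict N2" by (simp_all add: splits_def)
  have "unshuffle Q (cd M @ cd N) \<bullet> (M \<star> N) =
    (Id (cd M1) \<star> cc (cd M2) (cd N1) \<star> Id (cd N2)) \<bullet> (unshuffle Q (cd M) \<star> unshuffle Q (cd N)) \<bullet> (M \<star> N)"
    using * assms by (simp add: splits_def unshuffle_append)
  also have "(unshuffle Q (cd M) \<star> unshuffle Q (cd N)) \<bullet> (M \<star> N) =
    ((M1 \<star> M2) \<bullet> unshuffle Q (dm M)) \<star> ((N1 \<star> N2) \<bullet> unshuffle Q (dm N))"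
    using * assms(2) stns(1,2) by (simp add: splits_def stns_cmp)
  also have "\<dots> = ((M1 \<star> M2) \<star> (N1 \<star> N2)) \<bullet> (unshuffle Q (dm M) \<star> unshuffle Q (dm N))"
    using * assms(2) by (intro stns_cmp[symmetric]) (simp_all add: splits_def)
  also have "(Id (cd M1) \<star> cc (cd M2) (cd N1) \<star> Id (cd N2)) \<bullet> \<dots> =
    ((M1 \<star> N1) \<star> (M2 \<star> N2)) \<bullet> (Id (dm M1) \<star> cc (dm M2) (dm N1) \<star> Id (dm N2)) \<bullet> (unshuffle Q (dm M) \<star> unshuffle Q (dm N))"
    using cmp_cong_left[OF middle_natural[OF assms(2) s]] by simp
  also have "(Id (dm M1) \<star> cc (dm M2) (dm N1) \<star> Id (dm N2)) \<bullet> (unshuffle Q (dm M) \<star> unshuffle Q (dm N)) = unshuffle Q (dm M @ dm N)"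
    using * assms by (simp add: splits_def unshuffle_append)
  finally have "splits Q (M \<star> N) (M1 \<star> N1) (M2 \<star> N2)"
    using * stns by (simp add: splits_def)
  then show ?case by blast
qed

text \<open>The clause for one copy is separate because that map must be an identity in every
  category, whereas a recursion down to zero copies would bring in discarding.\<close>

fun copies :: "'p \<Rightarrow> nat \<Rightarrow> 'p mterm set" where
  "copies p 0 = kk [p]"
| "copies p (Suc 0) = Id [p]"
| "copies p (Suc (Suc n)) = (Id [p] \<star> copies p (Suc n)) \<bullet> ww [p]"

text \<open>The iterated diagonal \<open>copies p n\<close> is meaningful in the category only for copyable \<open>n\<close>.\<close>

definition copyable :: "nat \<Rightarrow> bool" where
  "copyable n \<longleftrightarrow> (n = 0 \<longrightarrow> has_k) \<and> (2 \<le> n \<longrightarrow> has_w)"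

lemma strict_copies [simp]:
  assumes "copyable n" shows "strict (copies p n)" "dm (copies p n) = [p]" "cd (copies p n) = replicate n p"
proof -
  have "strict (copies p n) \<and> dm (copies p n) = [p] \<and> cd (copies p n) = replicate n p"
    using assms
  proof (induction p n rule: copies.induct)
    case (3 p n)
    then have "has_w" "copyable (Suc n)" by (auto simp: copyable_def)
    then show ?case using 3 by simp
  qed (auto simp: copyable_def)
  then show "strict (copies p n)" "dm (copies p n) = [p]" "cd (copies p n) = replicate n p" by auto
qed

text \<open>The counit laws settle an empty summand, and coassociativity moves one copy at a time
  from the left factor to the front.\<close>

lemma copies_add:
  assumes "has_w" "copyable m" "copyable n"
  shows "(copies p m \<star> copies p n) \<bullet> ww [p] = copies p (m + n)"
  using assms(2)
proof (induction m rule: less_induct)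
  case (less m)
  consider "m = 0" | "m = 1" "n = 0" | "m = 1" "n \<noteq> 0" | l where "m = Suc (Suc l)"
    by (metis One_nat_def not0_implies_Suc)
  then show ?case
  proof cases
    case 1
    then have k: "has_k" using less by (simp add: copyable_def)
    have "(kk [p] \<star> copies p n) \<bullet> ww [p] = (Id [] \<star> copies p n) \<bullet> (kk [p] \<star> Id [p]) \<bullet> ww [p]"
      using k assms stns_exchange[of "kk [p]" "copies p n"] by (simp flip: cmp_assoc)
    then show ?thesis using 1 k assms by (simp add: kk_ww_left)
  next
    case 2
    then show ?thesis using assms by (simp add: copyable_def kk_ww_right)
  next
    case 3
    then show ?thesis by (cases n) simp_all
  next
    case (4 l)
    have o: "copyable (Suc l)" using assms by (simp add: copyable_def)
    have "(copies p m \<star> copies p n) \<bullet> ww [p] =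
        (((Id [p] \<star> copies p (Suc l)) \<bullet> ww [p]) \<star> (copies p n \<bullet> Id [p])) \<bullet> ww [p]"
      using 4 assms by simp
    also have "\<dots> = (Id [p] \<star> copies p (Suc l) \<star> copies p n) \<bullet> (ww [p] \<star> Id [p]) \<bullet> ww [p]"
      using assms o by (subst stns_cmp[symmetric]) simp_all
    also have "\<dots> = (Id [p] \<star> copies p (Suc l) \<star> copies p n) \<bullet> (Id [p] \<star> ww [p]) \<bullet> ww [p]"
      using assms by (simp add: ww_assoc)
    also have "\<dots> = (Id [p] \<star> ((copies p (Suc l) \<star> copies p n) \<bullet> ww [p])) \<bullet> ww [p]"
      using assms o by (simp add: Id_stns_cmp)
    also have "\<dots> = (Id [p] \<star> copies p (Suc l + n)) \<bullet> ww [p]"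
      using less.IH[of "Suc l"] 4 o by simp
    finally show ?thesis using 4 by simp
  qed
qed

text \<open>No generator creates letters out of the empty word: symmetry, diagonal and discarding
  are identities there.\<close>

lemma Nil_Id: "strict M \<Longrightarrow> dm M = [] \<Longrightarrow> M = Id []"
proof (induction rule: strict_induct)
  case (cmp M N)
  then have M: "M = Id []" by simp
  then have "dm N = []" using cmp(3) by simp
  then have N: "N = Id []" by (rule cmp(5))
  show ?case unfolding M N by simp
next
  case (stns M N)
  then have M: "M = Id []" and N: "N = Id []" by simp_all
  show ?case unfolding M N by simp
qed (simp_all add: ww_Nil kk_Nil)

lemma append_eq_replicateE:
  assumes "xs @ ys = replicate m p"
  obtains a b where "xs = replicate a p" "ys = replicate b p" "m = a + b"
proof
  have *: "set (xs @ ys) \<subseteq> {p}" unfolding assms by (auto simp: set_replicate_conv_if)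
  show "xs = replicate (length xs) p" "ys = replicate (length ys) p"
    using * by (auto intro!: replicate_length_same[symmetric])
  show "m = length xs + length ys" using arg_cong[OF assms, of length] by simp
qed

text \<open>The diagonal absorbs everything that could distinguish morphisms out of a power of
  \<open>p\<close>: symmetries by cocommutativity, diagonals and discarding by naturality. What is
  left is the number of copies in the target.\<close>

lemma cmp_copies:
  assumes "strict M" "dm M = replicate m p" "copyable m"
  shows "\<exists>n. copyable n \<and> cd M = replicate n p \<and> M \<bullet> copies p m = copies p n"
  using assms
proof (induction arbitrary: m rule: strict_induct)
  case (Id xs)
  then show ?case by auto
next
  case (cc xs ys)
  then have "xs @ ys = replicate m p" by simp
  then obtain a b where ab: "xs = replicate a p" "ys = replicate b p" "m = a + b"
    by (rule append_eq_replicateE)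
  show ?case
  proof (cases "a = 0 \<or> b = 0")
    case True
    then have "cc xs ys = Id (xs @ ys)" using cc ab by auto
    then show ?thesis using cc by (intro exI[of _ m]) (auto simp: ab)
  next
    case False
    then have w: "has_w" "copyable a" "copyable b" using cc.prems(2) ab by (auto simp: copyable_def)
    have "cc xs ys \<bullet> copies p (a + b) = (cc xs ys \<bullet> (copies p a \<star> copies p b)) \<bullet> ww [p]"
      using w by (simp flip: copies_add)
    also have "cc xs ys \<bullet> (copies p a \<star> copies p b) = (copies p b \<star> copies p a) \<bullet> cc [p] [p]"
      using cc_natural[of "copies p a" "copies p b"] cc w ab by simp
    also have "((copies p b \<star> copies p a) \<bullet> cc [p] [p]) \<bullet> ww [p] = copies p (b + a)"
      using w by (simp add: cc_ww copies_add)
    finally show ?thesis using cc ab by (intro exI[of _ m]) (simp add: add.commute flip: replicate_add)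
  qed
next
  case (ww xs)
  then have xs: "xs = replicate m p" by simp
  have "copyable (m + m)" using ww by (auto simp: copyable_def)
  moreover have "ww xs \<bullet> copies p m = copies p (m + m)"
    using ww_natural[of "copies p m"] ww xs by (simp add: copies_add)
  ultimately show ?case using ww xs by (auto simp: replicate_add)
next
  case (kk xs)
  then show ?case using kk_natural[of "copies p m"] by (intro exI[of _ 0]) (simp add: copyable_def)
next
  case (cmp M N)
  then obtain n where n: "copyable n" "cd M = replicate n p" "M \<bullet> copies p m = copies p n" by fastforce
  then obtain l where "copyable l" "cd N = replicate l p" "N \<bullet> copies p n = copies p l" using cmp by metis
  then show ?case using n cmp by auto
next
  case (stns M N)
  then have "dm M @ dm N = replicate m p" by simp
  then obtain a b where ab: "dm M = replicate a p" "dm N = replicate b p" "m = a + b"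
    by (rule append_eq_replicateE)
  show ?case
  proof (cases "a = 0 \<or> b = 0")
    \<comment> \<open>Again the diagonal may not split here, but a factor whose source is empty is
      the identity of the empty word.\<close>
    case True
    then show ?thesis
    proof
      assume "a = 0"
      then have "M = Id []" using stns ab by (intro Nil_Id) simp_all
      then show ?thesis using stns ab \<open>a = 0\<close> by simp
    next
      assume "b = 0"
      then have "N = Id []" using stns ab by (intro Nil_Id) simp_all
      then show ?thesis using stns ab \<open>b = 0\<close> by simp
    qed
  next
    case False
    then have w: "has_w" "copyable a" "copyable b" using stns.prems(2) ab by (auto simp: copyable_def)
    obtain a' b' where *: "copyable a'" "cd M = replicate a' p" "M \<bullet> copies p a = copies p a'"
      "copyable b'" "cd N = replicate b' p" "N \<bullet> copies p b = copies p b'"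
      using stns.IH(1)[OF ab(1)] stns.IH(2)[OF ab(2)] w by metis
    have "(M \<star> N) \<bullet> copies p (a + b) = ((M \<star> N) \<bullet> (copies p a \<star> copies p b)) \<bullet> ww [p]"
      using w by (simp flip: copies_add)
    also have "\<dots> = copies p (a' + b')"
      using w * stns ab by (simp add: stns_cmp copies_add)
    finally show ?thesis
      using * w ab stns by (intro exI[of _ "a' + b'"]) (auto simp: copyable_def replicate_add)
  qed
qed

theorem strict_coherence:
  assumes "has_c" "strict M" "strict N" "dm M = dm N" "cd M = cd N" "distinct (dm M)"
  shows "M = N"
  using assms(2-)
proof (induction "length (dm M)" arbitrary: M N rule: less_induct)
  case less
  consider "dm M = []" | p where "dm M = [p]" | p q xs where "dm M = p # q # xs"
    by (metis neq_Nil_conv)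
  then show ?case
  proof cases
    case 1
    then show ?thesis using Nil_Id less.prems by metis
  next
    case (2 p)
    have "copyable 1" by (simp add: copyable_def)
    then obtain n n' where "cd M = replicate n p" "M \<bullet> copies p 1 = copies p n"
        "cd N = replicate n' p" "N \<bullet> copies p 1 = copies p n'"
      using cmp_copies[of M 1 p] cmp_copies[of N 1 p] 2 less.prems by auto
    \<comment> \<open>\<open>copies p 1\<close> is the identity, and the common target word forces
      the two exponents to agree.\<close>
    then show ?thesis using 2 less.prems by (metis One_nat_def cmp_Id copies.simps(2) length_replicate)
  next
    case (3 p q xs)
    let ?Q = "(=) p"
    obtain M1 M2 where M: "splits ?Q M M1 M2" using unshuffle_natural less.prems assms(1) by blast
    obtain N1 N2 where N: "splits ?Q N N1 N2" using unshuffle_natural less.prems assms(1) by blast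
    \<comment> \<open>By distinctness exactly one letter is split off, so both parts have a shorter
      source and fall under the induction hypothesis.\<close>
    have d: "filter ?Q (dm M) = [p]" "[x \<leftarrow> dm M. \<not> ?Q x] = q # xs"
      using 3 less.prems(5) by (auto simp: filter_empty_conv filter_id_conv)
    have "M1 = N1" by (rule less.hyps) (use M N d 3 less.prems in \<open>simp_all add: splits_def\<close>)
    moreover have "M2 = N2" by (rule less.hyps) (use M N d 3 less.prems in \<open>simp_all add: splits_def\<close>)
    ultimately have e: "unshuffle ?Q (cd M) \<bullet> M = unshuffle ?Q (cd M) \<bullet> N"
      using M N less.prems by (simp add: splits_def)
    obtain R where R: "R \<bullet> unshuffle ?Q (cd M) = Id (cd M)" using unshuffle_left_inverse assms(1) by blast
    have "(R \<bullet> unshuffle ?Q (cd M)) \<bullet> M = (R \<bullet> unshuffle ?Q (cd M)) \<bullet> N" using e by simp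
    then show ?thesis using R less.prems by (simp del: cmp_assoc)
  qed
qed

section \<open>Transport along graphs and renaming of letters\<close>

lemma strictify_inject:
  assumes "valid M" "valid N" "dom M = dom N" "cod M = cod N" "strictify M = strictify N"
  shows "M = N"
proof -
  have "can (cod M) (nested (cd M)) \<bullet> M = can (cod M) (nested (cd M)) \<bullet> N"
    using strictify_can[of M] strictify_can[of N] assms by (simp add: dm_def cd_def)
  then have "(can (nested (cd M)) (cod M) \<bullet> can (cod M) (nested (cd M))) \<bullet> M =
      (can (nested (cd M)) (cod M) \<bullet> can (cod M) (nested (cd M))) \<bullet> N"
    by simp
  then show ?thesis using assms by (simp add: can_cmp cd_def del: cmp_assoc)
qed

theorem distinct_coherence:
  assumes "hom C A B f" "hom C A B g" "distinct (flat A)"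
  shows "meq C A B f g"
proof -
  have *: "valid (cl f)" "dom (cl f) = A" "cod (cl f) = B" "valid (cl g)" "dom (cl g) = A" "cod (cl g) = B"
    using assms cl_dom_cod by blast+
  have "cl f = cl g"
  proof (cases "C = Mon")
    \<comment> \<open>There are no unshuffles without symmetry, but here every term is
      monoidal.\<close>
    case True
    then have "hom Mon A B f" "hom Mon A B g" using assms by simp_all
    then have "mon (cl f)" "mon (cl g)" unfolding mon_def by blast+
    then show ?thesis using * monoidal_coherence[of "cl f" "cl g"] by simp
  next
    case False
    then have c: "has_c" using category.exhaust by (auto simp: has_c_def)
    have "strictify (cl f) = strictify (cl g)"
      by (rule strict_coherence[OF c])
        (use * assms(3) in \<open>simp_all add: strict_strictify\<close>, simp_all add: dm_def cd_def)
    then show ?thesis using * strictify_inject[of "cl f" "cl g"] by simp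
  qed
  then show ?thesis using assms(1) cl_eq_iff by blast
qed

end

text \<open>The action of the graph on lists of labels, one label per letter occurrence. With
  \<open>take\<close>, \<open>drop\<close> and append in place of index arithmetic on restricted
  domains, the equations are checked by list rewriting; with letters as labels it computes the word
  of the target of a lifted term.\<close>

primrec transport :: "'p mterm \<Rightarrow> 'a list \<Rightarrow> 'a list" where
  "transport (idt A) vs = vs"
| "transport (\<sigma> A) vs = vs"
| "transport (\<sigma>i A) vs = vs"
| "transport (\<delta> A) vs = vs"
| "transport (\<delta>i A) vs = vs"
| "transport (br A B D) vs = vs"
| "transport (bl A B D) vs = vs"
| "transport (c A B) vs = drop (len A) vs @ take (len A) vs"
| "transport (w A) vs = vs @ vs"
| "transport (k A) vs = []"
| "transport (g \<odot> f) vs = transport g (transport f vs)"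
| "transport (f \<boxtimes> g) vs = transport f (take (len (src f)) vs) @ transport g (drop (len (src f)) vs)"

lemma length_transport: "hom C A B f \<Longrightarrow> length vs = len A \<Longrightarrow> length (transport f vs) = len B"
  by (induction arbitrary: vs rule: hom.induct) (auto dest: hom_src_tgt)

lemma transport_eq:
  "meq C A B f g \<Longrightarrow> length vs = len A \<Longrightarrow> transport f vs = transport g vs"
proof (induction arbitrary: vs rule: meq.induct)
  case (meq_Comp A B f f' D g g')
  then show ?case using length_transport meq_hom by (metis transport.simps(11))
next
  case (meq_Mult A D f f' B E g g')
  then have "src f = A" "src f' = A" using hom_src_tgt meq_hom by blast+
  then show ?case using meq_Mult by simp
next
  case (interchange A1 B1 f1 D1 g1 A2 B2 f2 D2 g2)
  have st: "src f1 = A1" "tgt f1 = B1" "src g1 = B1"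
    using interchange.hyps hom_src_tgt by blast+
  have "length (transport f1 (take (len A1) vs)) = len B1"
    using interchange.hyps(1) interchange.prems by (intro length_transport) simp_all
  then show ?case using st by simp
next
  case (c_nat A D f B E g)
  have st: "src f = A" "tgt f = D" "src g = B" "tgt g = E"
    using c_nat.hyps(2,3) hom_src_tgt by blast+
  have "length (transport f (take (len A) vs)) = len D"
    using c_nat.hyps(2) c_nat.prems by (intro length_transport) simp_all
  then show ?case using st c_nat.prems by simp
next
  case (br_nat A D f B E g G F h)
  then have "src f = A" "src g = B" using hom_src_tgt by blast+
  then show ?case by (simp add: take_drop add.commute)
next
  case (hexagon A B D)
  then show ?case by (simp add: take_add add.commute)
qed (auto simp: length_transport cm_def dest: hom_src_tgt)

text \<open>Graph indices start at 1 and list positions at 0; the \<open>Suc\<close> form makes the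
  subtraction in \<open>transport_nth\<close> cancel.\<close>

lemma graph_Suc: "hom C A B f \<Longrightarrow> i < len B \<Longrightarrow> \<exists>j<len A. graph f (Suc i) = Suc j"
  using PiE_mem[OF graph_funcset, of C A B f "Suc i"] by (cases "graph f (Suc i)") auto

lemma transport_nth:
  "hom C A B f \<Longrightarrow> length vs = len A \<Longrightarrow> i < len B \<Longrightarrow> transport f vs ! i = vs ! (graph f (Suc i) - 1)"
proof (induction arbitrary: vs i rule: hom.induct)
  case (hom_c A B)
  then show ?case by (auto simp: nth_append)
next
  case (hom_w A)
  then show ?case by (auto simp: nth_append)
next
  case (hom_Comp A B f D g)
  have t: "tgt g = D" using hom_Comp.hyps hom_src_tgt by blast
  have "transport (g \<odot> f) vs ! i = transport f vs ! (graph g (Suc i) - 1)"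
    using hom_Comp.IH(2) length_transport[OF hom_Comp.hyps(1) hom_Comp.prems(1)] hom_Comp.prems(2) by simp
  also
  obtain j where j: "graph g (Suc i) = Suc j" "j < len B"
    using graph_Suc[OF hom_Comp.hyps(2) hom_Comp.prems(2)] by blast
  have "transport f vs ! (graph g (Suc i) - 1) = vs ! (graph f (Suc j) - 1)"
    using hom_Comp.IH(1)[OF hom_Comp.prems(1) j(2)] j(1) by simp
  finally show ?case using t j hom_Comp.prems by simp
next
  case (hom_Mult A D f B E g)
  have t: "src f = A" "tgt f = D" "src g = B" "tgt g = E" using hom_Mult.hyps hom_src_tgt by blast+
  have l: "length (transport f (take (len A) vs)) = len D"
    by (rule length_transport[OF hom_Mult.hyps(1)]) (use hom_Mult.prems in simp)
  show ?case
  proof (cases "i < len D")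
    case True
    then obtain j where "graph f (Suc i) = Suc j" "j < len A"
      using graph_Suc[OF hom_Mult.hyps(1)] by blast
    then show ?thesis using True hom_Mult.IH(1) hom_Mult.prems t l by (simp add: nth_append)
  next
    case False
    then have i: "i - len D < len E" using hom_Mult.prems by simp
    then obtain j where "graph g (Suc (i - len D)) = Suc j" "j < len B"
      using graph_Suc[OF hom_Mult.hyps(2)] by blast
    then show ?thesis using False i hom_Mult.IH(2) hom_Mult.prems t l
      by (simp add: nth_append Suc_diff_le)
  qed
qed auto

lemma graph_eq_iff_transport:
  assumes "hom C A B f" "hom C A B g"
  shows "graph f = graph g \<longleftrightarrow> (\<forall>vs :: nat list. length vs = len A \<longrightarrow> transport f vs = transport g vs)"
proof
  assume "graph f = graph g"
  then show "\<forall>vs :: nat list. length vs = len A \<longrightarrow> transport f vs = transport g vs"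
    using assms by (auto intro!: nth_equalityI simp: length_transport transport_nth)
next
  assume "\<forall>vs :: nat list. length vs = len A \<longrightarrow> transport f vs = transport g vs"
  \<comment> \<open>The list of positions has pairwise distinct entries, so its transport reveals
    the whole graph.\<close>
  then have transport: "transport f [0..<len A] = transport g [0..<len A]" by simp
  show "graph f = graph g"
  proof (rule PiE_ext[OF graph_funcset[OF assms(1)] graph_funcset[OF assms(2)]])
    fix i assume "i \<in> {1..len B}"
    then obtain j where j: "i = Suc j" "j < len B" by (cases i) auto
    obtain a b where ab: "graph f i = Suc a" "a < len A" "graph g i = Suc b" "b < len A"
      using graph_Suc[OF assms(1) j(2)] graph_Suc[OF assms(2) j(2)] j(1) by blast
    have "[0..<len A] ! a = [0..<len A] ! b"
      using arg_cong[OF transport, of "\<lambda>vs. vs ! j"] j ab by (simp add: transport_nth[OF assms(1)] transport_nth[OF assms(2)])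
    then show "graph f i = graph g i" using ab by simp
  qed
qed

section \<open>Renaming letters\<close>

lemma hom_map: "hom C A B f \<Longrightarrow> hom C (map_obj h A) (map_obj h B) (map_mterm h f)"
  by (induction rule: hom.induct) (auto intro: hom.intros simp del: hom_simps)

text \<open>The axioms are schematic in their objects, so a renaming, even one that merges letters,
  sends instances to instances.\<close>

lemma meq_map:
  "meq C A B f g \<Longrightarrow> meq C (map_obj h A) (map_obj h B) (map_mterm h f) (map_mterm h g)"
proof (induction rule: meq.induct)
  case (meq_sym A B f g)
  show ?case by (rule meq.meq_sym[OF meq_sym.IH])
next
  case (meq_trans A B f g i)
  show ?case by (rule meq.meq_trans[OF meq_trans.IH])
next
  \<comment> \<open>\<open>cm\<close> is a defined constant and has to be unfolded before the
    renaming can pass through it.\<close>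
  case (cm_w A B)
  then show ?case using meq.cm_w[of C "map_obj h A" "map_obj h B"] by (simp add: cm_def)
qed ((unfold mterm.map obj.map)?,
    rule meq_refl meq.meq_Comp meq.meq_Mult id_right id_left comp_assoc interchange id_mult sigma_nat
      delta_nat sigma_sigmai sigmai_sigma delta_deltai deltai_delta sigma_delta br_nat br_bl bl_br
      triangle pentagon c_nat c_c sigma_c hexagon w_nat w_Unit w_assoc c_w k_nat k_Unit
      sigma_k_w delta_k_w;
    (assumption | erule hom_map))+

lemma map_obj_Prod_iff: "map_obj h X = A \<cdot> B \<longleftrightarrow> (\<exists>A' B'. X = A' \<cdot> B' \<and> map_obj h A' = A \<and> map_obj h B' = B)"
  by (cases X) auto

lemma map_obj_Unit_iff: "map_obj h X = Unit \<longleftrightarrow> X = Unit"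
  by (cases X) auto

lemma length_flat [simp]: "length (flat A) = len A"
  by (induction A) auto

lemma len_map_obj [simp]: "len (map_obj h A) = len A"
  by (induction A) auto

text \<open>The shape of a term fixes how its source is taken apart, so a lift of the source lifts
  the whole term. As \<open>h\<close> may merge letters, \<open>B\<close> does not determine the
  letters of \<open>B'\<close>; they are obtained by transport from \<open>A'\<close>.\<close>

lemma hom_lift:
  assumes "hom C A B f" "map_obj h A' = A"
  shows "\<exists>B' f'. hom C A' B' f' \<and> map_obj h B' = B \<and> map_mterm h f' = f \<and> flat B' = transport f (flat A')"
  using assms
proof (induction arbitrary: A' rule: hom.induct)
  case (hom_idt A)
  then show ?case by (intro exI[of _ A'] exI[of _ "idt A'"]) simp
next
  case (hom_sigma A)
  then obtain X where "A' = Unit \<cdot> X" "map_obj h X = A" by (auto simp: map_obj_Prod_iff map_obj_Unit_iff)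
  then show ?case by (intro exI[of _ X] exI[of _ "\<sigma> X"]) simp
next
  case (hom_sigmai A)
  then show ?case by (intro exI[of _ "Unit \<cdot> A'"] exI[of _ "\<sigma>i A'"]) simp
next
  case (hom_delta A)
  then obtain X where "A' = X \<cdot> Unit" "map_obj h X = A" by (auto simp: map_obj_Prod_iff map_obj_Unit_iff)
  then show ?case by (intro exI[of _ X] exI[of _ "\<delta> X"]) simp
next
  case (hom_deltai A)
  then show ?case by (intro exI[of _ "A' \<cdot> Unit"] exI[of _ "\<delta>i A'"]) simp
next
  case (hom_br A B D)
  then obtain X Y Z where "A' = X \<cdot> Y \<cdot> Z" "map_obj h X = A" "map_obj h Y = B" "map_obj h Z = D"
    by (auto simp: map_obj_Prod_iff)
  then show ?case by (intro exI[of _ "(X \<cdot> Y) \<cdot> Z"] exI[of _ "br X Y Z"]) simp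
next
  case (hom_bl A B D)
  then obtain X Y Z where "A' = (X \<cdot> Y) \<cdot> Z" "map_obj h X = A" "map_obj h Y = B" "map_obj h Z = D"
    by (auto simp: map_obj_Prod_iff)
  then show ?case by (intro exI[of _ "X \<cdot> Y \<cdot> Z"] exI[of _ "bl X Y Z"]) simp
next
  case (hom_c A B)
  then obtain X Y where "A' = X \<cdot> Y" "map_obj h X = A" "map_obj h Y = B"
    by (auto simp: map_obj_Prod_iff)
  then show ?case using hom_c by (intro exI[of _ "Y \<cdot> X"] exI[of _ "c X Y"]) auto
next
  case (hom_w A)
  then show ?case by (intro exI[of _ "A' \<cdot> A'"] exI[of _ "w A'"]) simp
next
  case (hom_k A)
  then show ?case by (intro exI[of _ Unit] exI[of _ "k A'"]) simp
next
  case (hom_Comp A B f D g)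
  then obtain B' f' where f: "hom C A' B' f'" "map_obj h B' = B" "map_mterm h f' = f" "flat B' = transport f (flat A')"
    by blast
  then obtain D' g' where "hom C B' D' g'" "map_obj h D' = D" "map_mterm h g' = g" "flat D' = transport g (flat B')"
    using hom_Comp.IH(2) by blast
  then show ?case using f by (intro exI[of _ D'] exI[of _ "g' \<odot> f'"]) auto
next
  case (hom_Mult A D f B E g)
  then obtain X Y where X: "A' = X \<cdot> Y" "map_obj h X = A" "map_obj h Y = B"
    by (auto simp: map_obj_Prod_iff)
  obtain D' f' where f: "hom C X D' f'" "map_obj h D' = D" "map_mterm h f' = f" "flat D' = transport f (flat X)"
    using hom_Mult.IH(1) X by blast
  obtain E' g' where g: "hom C Y E' g'" "map_obj h E' = E" "map_mterm h g' = g" "flat E' = transport g (flat Y)"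
    using hom_Mult.IH(2) X by blast
  have "src f = A" using hom_Mult.hyps hom_src_tgt by blast
  \<comment> \<open>Renaming preserves length, so the cut that \<open>transport\<close> makes in
    \<open>flat A'\<close> falls exactly between \<open>X\<close> and \<open>Y\<close>.\<close>
  then have "len (src f) = len X" using X(2) len_map_obj[of h X] by simp
  then show ?case using f g X by (intro exI[of _ "D' \<cdot> E'"] exI[of _ "f' \<boxtimes> g'"]) auto
qed

text \<open>The fresh letters are the positions of the occurrences, counted from an offset, so that
  lookup in the original word undoes the numbering.\<close>

primrec number :: "nat \<Rightarrow> 'p obj \<Rightarrow> nat obj" where
  "number n (Letter p) = Letter n"
| "number n Unit = Unit"
| "number n (A \<cdot> B) = number n A \<cdot> number (n + len A) B"

lemma flat_number: "flat (number n A) = [n..<n + len A]"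
proof (induction A arbitrary: n)
  case (Prod A B)
  then show ?case using upt_add_eq_append[of n "n + len A" "len B"] by (simp add: add.assoc)
qed auto

text \<open>The surrounding \<open>xs\<close> and \<open>ys\<close> keep the lookup list fixed while
  the induction descends into a factor.\<close>

lemma map_number: "map_obj ((!) (xs @ flat A @ ys)) (number (length xs) A) = A"
proof (induction A arbitrary: xs ys)
  case (Prod A B)
  show ?case using Prod.IH(1)[of xs "flat B @ ys"] Prod.IH(2)[of "xs @ flat A" ys] by simp
qed auto

text \<open>Equal images force the same bracketing, and the word then supplies the letters.\<close>

lemma map_obj_flat_inject: "map_obj h A = map_obj h B \<Longrightarrow> flat A = flat B \<Longrightarrow> A = B"
proof (induction A arbitrary: B)
  case (Prod A1 A2)
  then obtain B1 B2 where B: "B = B1 \<cdot> B2" "map_obj h B1 = map_obj h A1" "map_obj h B2 = map_obj h A2"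
    by (metis map_obj_Prod_iff obj.simps(14))
  then have "len A1 = len B1" by (metis len_map_obj)
  then show ?case using Prod B by simp
next
  case (Letter p) then show ?case by (cases B) auto
next
  case Unit then show ?case by (cases B) auto
qed

theorem mainTheorem5:
  fixes C :: category
    and A B :: "'p::linorder obj"
    and f g :: "'p mterm"
  assumes "infinite (UNIV :: 'p set)"
    and "hom C A B f"
    and "hom C A B g"
  shows "meq C A B f g \<longleftrightarrow> graph f = graph g"
proof
  assume "meq C A B f g"
  then show "graph f = graph g" using graph_eq_iff_transport assms transport_eq by blast
next
  assume "graph f = graph g"
  then have transport: "transport f vs = transport g vs" if "length vs = len A" for vs :: "nat list"
    using graph_eq_iff_transport assms that by blast
  define A' where "A' = number 0 A"
  let ?h = "(!) (flat A)"
  have A': "map_obj ?h A' = A" "distinct (flat A')" "length (flat A') = len A"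
    using map_number[of "[]" A "[]"] by (simp_all add: A'_def flat_number)
  obtain B1 f' where f: "hom C A' B1 f'" "map_obj ?h B1 = B" "map_mterm ?h f' = f" "flat B1 = transport f (flat A')"
    using hom_lift[OF assms(2) A'(1)] by blast
  obtain B2 g' where g: "hom C A' B2 g'" "map_obj ?h B2 = B" "map_mterm ?h g' = g" "flat B2 = transport g (flat A')"
    using hom_lift[OF assms(3) A'(1)] by blast
  \<comment> \<open>Both lifted targets map to \<open>B\<close>, hence have its shape, and their
    words are transports of \<open>flat A'\<close> along terms with equal graphs.\<close>
  have "B1 = B2" using f g transport[OF A'(3)] by (intro map_obj_flat_inject[of ?h]) simp_all
  then have "meq C A' B1 f' g'"
    using free_category.distinct_coherence f(1) g(1) A'(2) by blast
  then show "meq C A B f g" using meq_map[of C A' B1 f' g' ?h] A'(1) f g by simp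
qed

end
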